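(* Let $(\mathcal M,I)$ be a symbolic matrix system over $\Sigma$ and let $(\Lambda,\sigma)=(\Lambda_{\mathcal M},\sigma_{\mathcal M})$ be the subshift it presents. Let $\phi$ be a forward automorphism of $(\Lambda,\sigma)$ defined by a properly strong shift equivalence in $N$-step $$(\mathcal P^{(j)},\mathcal Q^{(j)},X^{(j)},Y^{(j)}):(\mathcal M^{(j-1)},I^{(j-1)})\underset{1-pr}{\approx}(\mathcal M^{(j)},I^{(j)}),\qquad j=1,\dots,N,$$ where $(\mathcal M^{(0)},I^{(0)})=(\mathcal M^{(N)},I^{(N)})=(\mathcal M,I)$. For $l\in\mathbb Z_+$ put $$\mathcal P_{l,l+N}=\mathcal P^{(1)}_{2l}Y^{(1)}_{2l+1}\mathcal P^{(2)}_{2l+2}Y^{(2)}_{2l+3}\cdots\mathcal P^{(N)}_{2l+2N-2}Y^{(N)}_{2l+2N-1}.$$ Then for all integers $k\ge 0$, $n\ge 1$ the dynamical system $(\Lambda,\phi^k\sigma^n)$ is topologically conjugate to the subshift $(\Lambda_{\mathcal P^k\mathcal M^n},\sigma_{\mathcal P^k\mathcal M^n})$ presented by the symbolic matrix system $(\mathcal P^k\mathcal M^n,I^{kN+n})$ defined, for $l\in\mathbb Z_+$ and with $r=l(kN+n)$, by $$(\mathcal P^k\mathcal M^n)_{l,l+1}=\mathcal P_{r,r+N}\,\mathcal P_{r+N,r+2N}\cdots\mathcal P_{r+(k-1)N,r+kN}\cdot\mathcal M_{r+kN,r+kN+1}\,\mathcal M_{r+kN+1,r+kN+2}\cdots\mathcal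 M_{(l+1)(kN+n)-1,(l+1)(kN+n)},$$ $$I^{kN+n}_{l,l+1}=I_{r,r+1}I_{r+1,r+2}\cdots I_{(l+1)(kN+n)-1,(l+1)(kN+n)}.$$
   Context: Subshifts. $\mathbb Z_+=\{0,1,2,\dots\}$. For a finite alphabet $\Sigma$, $\sigma$ is the left shift on $\Sigma^{\mathbb Z}$; a subshift $(\Lambda,\sigma)$ is a closed $\Lambda\subset\Sigma^{\mathbb Z}$ with $\sigma(\Lambda)=\Lambda$; an automorphism is a homeomorphism of $\Lambda$ commuting with $\sigma$. $(X,f)$ and $(Y,g)$ are topologically conjugate if $hf=gh$ for some homeomorphism $h:X\to Y$. Symbolic matrices. A symbolic matrix over $\Sigma$ is a finite matrix whose entries are finite formal sums (possibly empty, written $0$) of elements of $\Sigma$. Products are formed formally, by concatenating symbols; $0$-$1$ matrices multiply in the obvious way. For a bijection $\kappa$ (a specification) from a subset of $\Sigma$ onto a subset of $\Sigma'$, $\mathcal A\overset{\kappa}{\simeq}\mathcal A'$ means that $\mathcal A'$ is obtained from $\mathcal A$ by replacing every symbol $a$ in its components by $\kappa(a)$. $CD=\{cd: c\in C,d\in D\}$. Symbolic matrix systems. A symbolic matrix system $(\mathcal M,I)$ over $\Sigma$ consists of $m(l)\times m(l+1)$ matrices $\mathcal M_{l,l+1}$ (symbolic over $\Sigma$) and $I_{l,l+1}$ (entries in $\{0,1\}$), $l\in\mathbb Z_+$, with $I_{l,l+1}\mathcal M_{l+1,l+2}=\mathcal M_{l,l+1}I_{l+1,l+2}$, each row of $I_{l,l+1}$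 having at least one $1$ and each column exactly one $1$. It is identified with the $\lambda$-graph system having vertex sets $V_l=\{v^l_1,\dots,v^l_{m(l)}\}$, an edge in $E_{l,l+1}$ from $v^l_i$ to $v^{l+1}_j$ labeled $\alpha$ for every occurrence of $\alpha$ in $\mathcal M_{l,l+1}(i,j)$, and surjections $\iota:V_{l+1}\to V_l$ with $\iota(v^{l+1}_j)=v^l_i$ iff $I_{l,l+1}(i,j)=1$. Standing assumptions: every vertex emits an edge and every vertex in $V_l$, $l\ge1$, receives one; no two distinct edges have the same source, terminal and label (essential); distinct edges with the same label have distinct terminals (left-resolving). The presented subshift $(\Lambda_{\mathcal M},\sigma_{\mathcal M})$ consists of the bi-infinite sequences all of whose finite subwords are label words of finite paths (consecutive edges in $E_{l,l+1},E_{l+1,l+2},\dots$, starting at any level $l$). Proper strong shift equivalence. $(\mathcal P,\mathcal Q,X,Y):(\mathcal M,I)\underset{1-pr}{\approx}(\mathcal M',I')$ (over $\Sigma,\Sigma'$) means: there are alphabets $C,D$, specifications $\kappa:\Sigma\to CD$, $\kappa':\Sigma'\to DC$, and increasing (not necessarily strictly) sequences $n(l),n'(l)$, $l\in\mathbb Z_+$, and for each $l$ an $n(l)\times n'(l+1)$ matrix $\mathcal P_l$ over $C$, an $n'(l)\times n(l+1)$ matrix $\mathcal Q_l$ over $D$, an $n(l)\times n(l+1)$ $0$-$1$ matrix $X_l$ and an $n'(l)\times n'(l+1)$ $0$-$1$ matrix $Y_l$ such that for all $l\in\mathbb Z_+$ $$\mathcal M_{l,l+1}\overset{\kappa}{\simeq}\mathcal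 P_{2l}\mathcal Q_{2l+1},\quad \mathcal M'_{l,l+1}\overset{\kappa'}{\simeq}\mathcal Q_{2l}\mathcal P_{2l+1},\quad I_{l,l+1}=X_{2l}X_{2l+1},\quad I'_{l,l+1}=Y_{2l}Y_{2l+1},$$ $$X_l\mathcal P_{l+1}=\mathcal P_lY_{l+1},\qquad Y_l\mathcal Q_{l+1}=\mathcal Q_lX_{l+1}.$$ A properly strong shift equivalence in $N$-step is a chain of $N$ such $1$-step equivalences; the data of the $j$-th step are written $C^{(j)},D^{(j)}$, $\kappa_0^{(j)}:\Sigma^{(j-1)}\to C^{(j)}D^{(j)}$, $\kappa_1^{(j)}:\Sigma^{(j)}\to D^{(j)}C^{(j)}$, $\mathcal P^{(j)}_l,\mathcal Q^{(j)}_l,X^{(j)}_l,Y^{(j)}_l$, where $\Sigma^{(j)}$ is the alphabet of $(\mathcal M^{(j)},I^{(j)})$ and $\Sigma^{(0)}=\Sigma^{(N)}=\Sigma$. Forward automorphism. Let $\zeta_+^{(j)}$ send $(c_id_i)_{i\in\mathbb Z}$ to $(d_ic_{i+1})_{i\in\mathbb Z}$ ($c_i\in C^{(j)}$, $d_i\in D^{(j)}$), and let specifications act on sequences symbolwise. The forward automorphism of $\Lambda_{\mathcal M}$ defined by the chain is $$\phi=\big((\kappa_1^{(N)})^{-1}\circ\zeta_+^{(N)}\circ\kappa_0^{(N)}\big)\circ\cdots\circ\big((\kappa_1^{(1)})^{-1}\circ\zeta_+^{(1)}\circ\kappa_0^{(1)}\big).$$ For $k=0$ the product of the $\mathcal P$'s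 is empty. The words occurring in $(\mathcal P^k\mathcal M^n)_{l,l+1}$ are regarded as single symbols of the alphabet of $(\mathcal P^k\mathcal M^n,I^{kN+n})$. *)

theory Defs
  imports "HOL-Analysis.Function_Topology" "HOL-Library.Multiset" "Jordan_Normal_Form.Matrix"
begin

section \<open>Formal sums of words\<close>

text \<open>
  A finite formal sum of symbols is a multiset. Words are lists, with concatenation as the
  (non-commutative) addition of a monoid with neutral element \<open>[]\<close>; formal sums of words then
  form a semiring in which \<open>A * B\<close> is the formal product obtained by concatenating every word
  of \<open>A\<close> with every word of \<open>B\<close>, \<open>0\<close> is the empty sum and \<open>1\<close> is the empty word.
\<close>

instantiation list :: (type) monoid_add
begin
definition zero_list_def: "0 = []"
definition plus_list_def: "u + v = u @ v"
instance by standard (simp_all add: zero_list_def plus_list_def)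
end

instantiation multiset :: (monoid_add) semiring_1
begin

definition one_multiset_def: "1 = {#0#}"

definition times_multiset_def: "A * B = (\<Sum>u\<in>#A. image_mset (\<lambda>v. u + v) B)"

instance
proof
  fix A B C :: "'a multiset"
  show dist_r: "(A + B) * C = A * C + B * C" for A B C :: "'a multiset"
    by (simp add: times_multiset_def)
  show "A * (B + C) = A * B + A * C"
    by (induction A) (simp_all add: times_multiset_def ac_simps)
  show z: "0 * A = 0" "A * 0 = 0" for A :: "'a multiset"
    by (induction A) (simp_all add: times_multiset_def)
  have sgl: "image_mset (\<lambda>v. u + v) B * C = image_mset (\<lambda>v. u + v) (B * C)" for u B and C :: "'a multiset"
    by (induction B) (auto intro!: image_mset_cong simp: times_multiset_def multiset.map_comp o_def add.assoc)
  show "A * B * C = A * (B * C)"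
  proof (induction A)
    case empty
    show ?case by (simp add: times_multiset_def)
  next
    case (add u A)
    have *: "add_mset u A * D = image_mset (\<lambda>v. u + v) D + A * D" for D
      by (simp add: times_multiset_def)
    show ?case
      by (simp only: * dist_r sgl add.IH)
  qed
  show "1 * A = A"
    by (induction A) (simp_all add: times_multiset_def one_multiset_def)
  show "A * 1 = A"
    by (induction A) (simp_all add: times_multiset_def one_multiset_def)
  show "(0 :: 'a multiset) \<noteq> 1"
    by (simp add: one_multiset_def)
qed

end


section \<open>Symbolic matrices\<close>

type_synonym 'a symbolic_matrix = "'a multiset mat"
type_synonym 'a word_matrix = "'a list multiset mat"

definition symbols_of :: "'a symbolic_matrix \<Rightarrow> 'a set" where
  "symbols_of A = (\<Union>e\<in>elements_mat A. set_mset e)"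

abbreviation symbolic_over :: "'a symbolic_matrix \<Rightarrow> 'a set \<Rightarrow> bool" where
  "symbolic_over A S \<equiv> symbols_of A \<subseteq> S"

definition zero_one_matrix :: "nat mat \<Rightarrow> bool" where
  "zero_one_matrix A \<longleftrightarrow> elements_mat A \<subseteq> {0, 1}"

text \<open>
  In order to be multiplied, symbolic matrices and 0-1 matrices are both read as matrices of
  formal sums of words: a symbol is a word of length one, and \<open>n\<close> is \<open>n\<close> times the empty word.
\<close>

definition wd :: "'a symbolic_matrix \<Rightarrow> 'a word_matrix" where
  "wd A = map_mat (image_mset (\<lambda>a. [a])) A"

definition zo :: "nat mat \<Rightarrow> 'a word_matrix" where
  "zo A = map_mat of_nat A"

text \<open>Product of a list of matrices, the first of which has \<open>d\<close> rows.\<close>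

definition mat_prod :: "nat \<Rightarrow> 'b::semiring_1 mat list \<Rightarrow> 'b mat" where
  "mat_prod d As = foldl (*) (1\<^sub>m d) As"

definition concat_alphabets :: "'a set \<Rightarrow> 'a set \<Rightarrow> 'a list set" where
  "concat_alphabets C D = {[c, d] | c d. c \<in> C \<and> d \<in> D}"

text \<open>A specification is a bijection from a subset of the first alphabet onto a subset of the
  second one, hence an injective partial map.\<close>

definition specification_map :: "('a \<rightharpoonup> 'b) \<Rightarrow> 'a set \<Rightarrow> 'b set \<Rightarrow> bool" where
  "specification_map \<kappa> S T \<longleftrightarrow> dom \<kappa> \<subseteq> S \<and> ran \<kappa> \<subseteq> T \<and> inj_on \<kappa> (dom \<kappa>)"

definition spec_equivalent :: "('a \<rightharpoonup> 'b) \<Rightarrow> 'a symbolic_matrix \<Rightarrow> 'b symbolic_matrix \<Rightarrow> bool" where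
  "spec_equivalent \<kappa> A B \<longleftrightarrow>
     symbols_of A \<subseteq> dom \<kappa> \<and> B = map_mat (image_mset (\<lambda>a. the (\<kappa> a))) A"


section \<open>Symbolic matrix systems and the subshifts they present\<close>

record 'a matrix_system =
  alphabet :: "'a set"
  sym_mat :: "nat \<Rightarrow> 'a symbolic_matrix"    \<comment> \<open>\<open>sym_mat S l\<close> is $\mathcal M_{l,l+1}$\<close>
  inc_mat :: "nat \<Rightarrow> nat mat"               \<comment> \<open>\<open>inc_mat S l\<close> is $I_{l,l+1}$\<close>

definition msize :: "'a matrix_system \<Rightarrow> nat \<Rightarrow> nat" where
  "msize S l = dim_row (sym_mat S l)"

text \<open>The last four clauses are the standing assumptions on the associated $\lambda$-graph system:
  every vertex emits an edge, every vertex not at level 0 receives one, and the graph is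
  essential and left-resolving.\<close>

definition symbolic_matrix_system :: "'a matrix_system \<Rightarrow> bool" where
  "symbolic_matrix_system S \<longleftrightarrow>
     (let m = msize S; M = sym_mat S; I = inc_mat S in
       finite (alphabet S) \<and>
       (\<forall>l. M l \<in> carrier_mat (m l) (m (Suc l)) \<and> symbolic_over (M l) (alphabet S)) \<and>
       (\<forall>l. I l \<in> carrier_mat (m l) (m (Suc l)) \<and> zero_one_matrix (I l)) \<and>
       (\<forall>l. zo (I l) * wd (M (Suc l)) = wd (M l) * zo (I (Suc l))) \<and>
       (\<forall>l. \<forall>i<m l. \<exists>j<m (Suc l). I l $$ (i, j) = 1) \<and>
       (\<forall>l. \<forall>j<m (Suc l). \<exists>!i. i < m l \<and> I l $$ (i, j) = 1) \<and>
       (\<forall>l. \<forall>i<m l. \<exists>j<m (Suc l). M l $$ (i, j) \<noteq> {#}) \<and>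
       (\<forall>l. \<forall>j<m (Suc l). \<exists>i<m l. M l $$ (i, j) \<noteq> {#}) \<and>
       (\<forall>l. \<forall>i<m l. \<forall>j<m (Suc l). \<forall>a. count (M l $$ (i, j)) a \<le> 1) \<and>
       (\<forall>l. \<forall>i<m l. \<forall>i'<m l. \<forall>j<m (Suc l). \<forall>a.
          a \<in># M l $$ (i, j) \<and> a \<in># M l $$ (i', j) \<longrightarrow> i = i'))"

text \<open>\<open>labelled_path S l i w j\<close>: a path labelled \<open>w\<close> from the vertex \<open>i\<close> of level \<open>l\<close> to the
  vertex \<open>j\<close> of level \<open>l + length w\<close>; vertices are numbered from 0.\<close>

primrec labelled_path :: "'a matrix_system \<Rightarrow> nat \<Rightarrow> nat \<Rightarrow> 'a list \<Rightarrow> nat \<Rightarrow> bool" where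
  "labelled_path S l i [] j \<longleftrightarrow> i < msize S l \<and> i = j"
| "labelled_path S l i (a # w) j \<longleftrightarrow> i < msize S l \<and>
     (\<exists>i'<msize S (Suc l). a \<in># sym_mat S l $$ (i, i') \<and> labelled_path S (Suc l) i' w j)"

declare labelled_path.simps [simp del]

definition presented_subshift :: "'a matrix_system \<Rightarrow> (int \<Rightarrow> 'a) set" where
  "presented_subshift S =
     {x. \<forall>p n. \<exists>l i j. labelled_path S l i (map (\<lambda>t. x (p + int t)) [0..<n]) j}"

definition shift :: "(int \<Rightarrow> 'a) \<Rightarrow> int \<Rightarrow> 'a" where
  "shift x = (\<lambda>i. x (i + 1))"

text \<open>For a set of sequences over an alphabet this is also the topology inherited from the
  product of copies of the discrete alphabet.\<close>

definition shift_topology :: "(int \<Rightarrow> 'a) set \<Rightarrow> (int \<Rightarrow> 'a) topology" where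
  "shift_topology L = subtopology (product_topology (\<lambda>_. discrete_topology UNIV) UNIV) L"

text \<open>The first two clauses say that \<open>(X, f)\<close> and \<open>(Y, g)\<close> are dynamical systems; in particular
  \<open>f\<close> and \<open>g\<close> map the underlying spaces to themselves.\<close>

definition topologically_conjugate ::
    "'x topology \<Rightarrow> ('x \<Rightarrow> 'x) \<Rightarrow> 'y topology \<Rightarrow> ('y \<Rightarrow> 'y) \<Rightarrow> bool" where
  "topologically_conjugate X f Y g \<longleftrightarrow>
     continuous_map X X f \<and> continuous_map Y Y g \<and>
     (\<exists>h. homeomorphic_map X Y h \<and> (\<forall>x\<in>topspace X. h (f x) = g (h x)))"


section \<open>Proper strong shift equivalence\<close>

record 'a psse_data =
  alphC :: "'a set"
  alphD :: "'a set"
  kappa0 :: "'a \<rightharpoonup> 'a list"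
  kappa1 :: "'a \<rightharpoonup> 'a list"
  matP :: "nat \<Rightarrow> 'a symbolic_matrix"
  matQ :: "nat \<Rightarrow> 'a symbolic_matrix"
  matX :: "nat \<Rightarrow> nat mat"
  matY :: "nat \<Rightarrow> nat mat"

definition psse_one_step :: "'a psse_data \<Rightarrow> 'a matrix_system \<Rightarrow> 'a matrix_system \<Rightarrow> bool" where
  "psse_one_step E S S' \<longleftrightarrow>
     (let P = matP E; Q = matQ E; X = matX E; Y = matY E in
       finite (alphC E) \<and> finite (alphD E) \<and>
       specification_map (kappa0 E) (alphabet S) (concat_alphabets (alphC E) (alphD E)) \<and>
       specification_map (kappa1 E) (alphabet S') (concat_alphabets (alphD E) (alphC E)) \<and>
       (\<exists>n n'. mono n \<and> mono n' \<and>
         (\<forall>l. P l \<in> carrier_mat (n l) (n' (Suc l)) \<and> symbolic_over (P l) (alphC E) \<and>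
              Q l \<in> carrier_mat (n' l) (n (Suc l)) \<and> symbolic_over (Q l) (alphD E) \<and>
              X l \<in> carrier_mat (n l) (n (Suc l)) \<and> zero_one_matrix (X l) \<and>
              Y l \<in> carrier_mat (n' l) (n' (Suc l)) \<and> zero_one_matrix (Y l))) \<and>
       (\<forall>l. spec_equivalent (kappa0 E) (sym_mat S l) (wd (P (2 * l)) * wd (Q (2 * l + 1))) \<and>
            spec_equivalent (kappa1 E) (sym_mat S' l) (wd (Q (2 * l)) * wd (P (2 * l + 1))) \<and>
            inc_mat S l = X (2 * l) * X (2 * l + 1) \<and>
            inc_mat S' l = Y (2 * l) * Y (2 * l + 1) \<and>
            zo (X l) * wd (P (Suc l)) = wd (P l) * zo (Y (Suc l)) \<and>
            zo (Y l) * wd (Q (Suc l)) = wd (Q l) * zo (X (Suc l))))"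

text \<open>A chain of \<open>N\<close> steps; step \<open>j \<in> {1..N}\<close>, with data \<open>E j\<close>, leads from \<open>S (j - 1)\<close> to \<open>S j\<close>.\<close>

definition psse_chain ::
    "nat \<Rightarrow> (nat \<Rightarrow> 'a psse_data) \<Rightarrow> (nat \<Rightarrow> 'a matrix_system) \<Rightarrow> bool" where
  "psse_chain N E S \<longleftrightarrow>
     (\<forall>j\<le>N. symbolic_matrix_system (S j)) \<and>
     (\<forall>j\<in>{1..N}. psse_one_step (E j) (S (j - 1)) (S j))"


section \<open>The forward automorphism\<close>

definition apply_spec :: "('a \<rightharpoonup> 'b) \<Rightarrow> (int \<Rightarrow> 'a) \<Rightarrow> int \<Rightarrow> 'b" where
  "apply_spec \<kappa> x = (\<lambda>i. the (\<kappa> (x i)))"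

definition apply_spec_inv :: "('a \<rightharpoonup> 'b) \<Rightarrow> (int \<Rightarrow> 'b) \<Rightarrow> int \<Rightarrow> 'a" where
  "apply_spec_inv \<kappa> y = (\<lambda>i. THE a. \<kappa> a = Some (y i))"

text \<open>$(c_i d_i)_i \mapsto (d_i c_{i+1})_i$\<close>

definition zeta_plus :: "(int \<Rightarrow> 'a list) \<Rightarrow> int \<Rightarrow> 'a list" where
  "zeta_plus y = (\<lambda>i. [y i ! 1, y (i + 1) ! 0])"

definition step_map :: "'a psse_data \<Rightarrow> (int \<Rightarrow> 'a) \<Rightarrow> int \<Rightarrow> 'a" where
  "step_map E = apply_spec_inv (kappa1 E) \<circ> zeta_plus \<circ> apply_spec (kappa0 E)"

primrec forward_automorphism :: "(nat \<Rightarrow> 'a psse_data) \<Rightarrow> nat \<Rightarrow> (int \<Rightarrow> 'a) \<Rightarrow> int \<Rightarrow> 'a" where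
  "forward_automorphism E 0 = id"
| "forward_automorphism E (Suc j) = step_map (E (Suc j)) \<circ> forward_automorphism E j"


section \<open>The system $(\mathcal P^k\mathcal M^n, I^{kN+n})$\<close>

text \<open>$\mathcal P_{l,l+N}$; the list runs over the steps \<open>j = 1, \<dots>, N\<close>.\<close>

definition P_block :: "'a matrix_system \<Rightarrow> (nat \<Rightarrow> 'a psse_data) \<Rightarrow> nat \<Rightarrow> nat \<Rightarrow> 'a word_matrix" where
  "P_block S E N l = mat_prod (msize S l)
     (concat (map (\<lambda>j. [wd (matP (E j) (2 * l + 2 * j - 2)), zo (matY (E j) (2 * l + 2 * j - 1))])
                  [1..<Suc N]))"

definition PM_mat ::
    "'a matrix_system \<Rightarrow> (nat \<Rightarrow> 'a psse_data) \<Rightarrow> nat \<Rightarrow> nat \<Rightarrow> nat \<Rightarrow> nat \<Rightarrow> 'a word_matrix" where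
  "PM_mat S E N k n l =
     (let r = l * (k * N + n) in
       mat_prod (msize S r)
         (map (\<lambda>t. P_block S E N (r + t * N)) [0..<k] @
          map (\<lambda>s. wd (sym_mat S s)) [r + k * N..<Suc l * (k * N + n)]))"

definition I_power :: "'a matrix_system \<Rightarrow> nat \<Rightarrow> nat \<Rightarrow> nat mat" where
  "I_power S q l = mat_prod (msize S (l * q)) (map (inc_mat S) [l * q..<Suc l * q])"

text \<open>The words in the entries of \<open>PM_mat\<close> are the symbols of this system.\<close>

definition PM_system ::
    "'a matrix_system \<Rightarrow> (nat \<Rightarrow> 'a psse_data) \<Rightarrow> nat \<Rightarrow> nat \<Rightarrow> nat \<Rightarrow> 'a list matrix_system" where
  "PM_system S E N k n =
     \<lparr>alphabet = (\<Union>l. symbols_of (PM_mat S E N k n l)),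
      sym_mat = PM_mat S E N k n,
      inc_mat = I_power S (k * N + n)\<rparr>"

end

theory Submission
  imports Defs "HOL-Analysis.T1_Spaces"
begin

text \<open>
  Write \<open>x\<^sub>i = c\<^sub>i d\<^sub>i\<close>. Reading off \<open>c\<^sub>0\<close> from a one-sided sequence \<open>x\<^sub>0 x\<^sub>1 \<dots>\<close> leaves
  \<open>d\<^sub>0 c\<^sub>1, d\<^sub>1 c\<^sub>2, \<dots>\<close>, its image under the step map, and the relations \<open>X P = P Y\<close>, \<open>Y Q = Q X\<close>
  turn a path labelled \<open>x\<close> into an edge of \<open>P Y\<close> labelled \<open>c\<^sub>0\<close> followed by a path labelled with the
  remainder, and conversely. In the same way, reading off \<open>x\<^sub>0\<close> with an edge of \<open>M\<close> leaves the
  shift of \<open>x\<close>. Such transfers compose, so the edges of $\mathcal P^k\mathcal M^n$ read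
  off a word from \<open>x\<close> and leave \<open>\<tau> x\<close> with \<open>\<tau> = \<phi>\<^sup>k \<sigma>\<^sup>n\<close>. The conjugacy maps \<open>x\<close> to the sequence of
  words read off from \<open>\<tau>\<^sup>t x\<close>, \<open>t \<in> \<int>\<close>. It is injective since each application of \<open>\<tau>\<close> consumes
  \<open>n \<ge> 1\<close> symbols of \<open>x\<close>, and surjective by reading paths backwards and compactness.
\<close>

section \<open>Matrices of formal sums\<close>

text \<open>The equivalence ties indices of \<open>P\<close>, \<open>Q\<close>, \<open>X\<close>,
  \<open>Y\<close> to vertices only when they are even; the intermediate vertices at odd indices
  carry none of the standing assumptions. Row, column and resolving properties of \<open>P Y\<close>
  must therefore be extracted from the two systems on either side, through the commutation relations
  and through the dual equivalence that exchanges \<open>P\<close> and \<open>Q\<close>. One gap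
  remains: at level 0 a column of \<open>P Y\<close> is not excluded from being zero, although level
  1 of the final system must receive edges from level 0. A letter matrix behind the \<open>P\<close>
  factors closes it, which is a second use of n \<ge> 1. Two counters are kept apart: the levels
  climbed and the symbols lost. A step of the chain counts 1 and 0, since it takes c and leaves d
  inside the image; a letter counts 1 and 1. Together they give kN+n levels but only n lost symbols.
  Reading backwards determines only the nonnegative half of a sequence, so statements about images
  are agreements from 0 on; two-sided points enter through extension to the left and
  compactness.\<close>

lemma set_mset_times: "set_mset (A * B) = {u + v |u v. u \<in># A \<and> v \<in># B}"
  by (auto simp: times_multiset_def)

lemma of_nat_multiset: "(of_nat n :: 'a::monoid_add multiset) = replicate_mset n 0"
  by (induction n) (auto simp: one_multiset_def)

lemma index_mult_sum:
  assumes "A \<in> carrier_mat a b" "B \<in> carrier_mat b c" "i < a" "j < c"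
  shows "(A * B) $$ (i, j) = (\<Sum>h<b. A $$ (i, h) * B $$ (h, j))"
  using assms by (auto simp: scalar_prod_def lessThan_atLeast0 intro!: sum.cong)

lemma mem_mult_mat:
  fixes A B :: "'a word_matrix"
  assumes "A \<in> carrier_mat a b" "B \<in> carrier_mat b c" "i < a" "j < c"
  shows "w \<in># (A * B) $$ (i, j) \<longleftrightarrow>
    (\<exists>h<b. \<exists>u v. u \<in># A $$ (i, h) \<and> v \<in># B $$ (h, j) \<and> w = u @ v)"
  unfolding index_mult_sum[OF assms]
  by (auto simp: set_mset_sum set_mset_times plus_list_def)

lemma wd_carrier [simp]: "wd A \<in> carrier_mat a b \<longleftrightarrow> A \<in> carrier_mat a b"
  by (simp add: wd_def)

lemma zo_carrier [simp]: "zo A \<in> carrier_mat a b \<longleftrightarrow> A \<in> carrier_mat a b"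
  by (simp add: zo_def)

lemma mem_wd:
  assumes "A \<in> carrier_mat a b" "i < a" "j < b"
  shows "w \<in># wd A $$ (i, j) \<longleftrightarrow> (\<exists>c. w = [c] \<and> c \<in># A $$ (i, j))"
  using assms by (auto simp: wd_def)

lemma mem_zo:
  assumes "A \<in> carrier_mat a b" "i < a" "j < b"
  shows "w \<in># zo A $$ (i, j) \<longleftrightarrow> w = [] \<and> A $$ (i, j) \<noteq> 0"
  using assms by (auto simp: zo_def of_nat_multiset zero_list_def)

lemma mem_wd_zo:
  assumes "A \<in> carrier_mat a b" "B \<in> carrier_mat b c" "i < a" "j < c"
  shows "w \<in># (wd A * zo B) $$ (i, j) \<longleftrightarrow>
    (\<exists>h<b. \<exists>x. w = [x] \<and> x \<in># A $$ (i, h) \<and> B $$ (h, j) \<noteq> 0)"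
  using assms by (auto simp: mem_mult_mat[of _ a b _ c] mem_wd mem_zo simp del: index_mult_mat(1))

lemma mem_zo_wd:
  assumes "A \<in> carrier_mat a b" "B \<in> carrier_mat b c" "i < a" "j < c"
  shows "w \<in># (zo A * wd B) $$ (i, j) \<longleftrightarrow>
    (\<exists>h<b. \<exists>x. w = [x] \<and> A $$ (i, h) \<noteq> 0 \<and> x \<in># B $$ (h, j))"
  using assms by (auto simp: mem_mult_mat[of _ a b _ c] mem_wd mem_zo simp del: index_mult_mat(1))

lemma mem_wd_wd:
  assumes "A \<in> carrier_mat a b" "B \<in> carrier_mat b c" "i < a" "j < c"
  shows "w \<in># (wd A * wd B) $$ (i, j) \<longleftrightarrow>
    (\<exists>h<b. \<exists>x y. w = [x, y] \<and> x \<in># A $$ (i, h) \<and> y \<in># B $$ (h, j))"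
proof -
  have "w \<in># (wd A * wd B) $$ (i, j) \<longleftrightarrow>
      (\<exists>h<b. \<exists>u v. u \<in># wd A $$ (i, h) \<and> v \<in># wd B $$ (h, j) \<and> w = u @ v)"
    using assms by (intro mem_mult_mat) auto
  also have "\<dots> \<longleftrightarrow> (\<exists>h<b. \<exists>x y. w = [x, y] \<and> x \<in># A $$ (i, h) \<and> y \<in># B $$ (h, j))"
  proof -
    have "(\<exists>u v. (\<exists>x. u = [x] \<and> P x) \<and> (\<exists>y. v = [y] \<and> Q y) \<and> w = u @ v) \<longleftrightarrow>
        (\<exists>x y. w = [x, y] \<and> P x \<and> Q y)" for P Q :: "'a \<Rightarrow> bool"
      by (rule iffI; elim exE conjE) (simp, rule exI[of _ "[_]"], simp)
    then show ?thesis
      by (simp add: mem_wd[OF assms(1,3)] mem_wd[OF assms(2) _ assms(4)] cong: conj_cong)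
  qed
  finally show ?thesis .
qed

lemma nat_mult_mat_nonzero:
  fixes A B :: "nat mat"
  assumes "A \<in> carrier_mat a b" "B \<in> carrier_mat b c" "i < a" "j < c"
  shows "(A * B) $$ (i, j) \<noteq> 0 \<longleftrightarrow> (\<exists>h<b. A $$ (i, h) \<noteq> 0 \<and> B $$ (h, j) \<noteq> 0)"
  unfolding index_mult_sum[OF assms] by auto

lemma zo_mult:
  assumes "A \<in> carrier_mat a b" "B \<in> carrier_mat b c"
  shows "zo (A * B) = zo A * zo B"
  by (rule eq_matI)
    (use assms in \<open>auto simp: zo_def index_mult_sum[of _ a b _ c] simp del: index_mult_mat(1)\<close>)

lemma zo_one: "zo (1\<^sub>m a) = 1\<^sub>m a"
  by (rule eq_matI) (auto simp: zo_def)

lemma elements_mat_carrier: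
  assumes "A \<in> carrier_mat a b"
  shows "elements_mat A = (\<lambda>(i, j). A $$ (i, j)) ` ({..<a} \<times> {..<b})"
  using assms by (auto simp: elements_mat_def)

lemma symbols_of_carrier:
  assumes "A \<in> carrier_mat a b"
  shows "symbols_of A = (\<Union>i<a. \<Union>j<b. set_mset (A $$ (i, j)))"
  by (auto simp: symbols_of_def elements_mat_carrier[OF assms])

lemma symbols_of_mult:
  fixes A B :: "'a word_matrix"
  assumes "A \<in> carrier_mat a b" "B \<in> carrier_mat b c" "w \<in> symbols_of (A * B)"
  obtains u v where "u \<in> symbols_of A" "v \<in> symbols_of B" "w = u @ v"
proof -
  obtain i j where ij: "i < a" "j < c" "w \<in># (A * B) $$ (i, j)"
    using assms(3) mult_carrier_mat[OF assms(1,2)] by (auto simp: symbols_of_carrier simp del: index_mult_mat(1))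
  then obtain h u v where "h < b" "u \<in># A $$ (i, h)" "v \<in># B $$ (h, j)" "w = u @ v"
    by (auto simp: mem_mult_mat[OF assms(1,2)] simp del: index_mult_mat(1))
  with ij that show ?thesis
    by (auto simp: symbols_of_carrier[OF assms(1)] symbols_of_carrier[OF assms(2)])
qed

lemma zero_one_matrix_carrier:
  assumes "A \<in> carrier_mat a b"
  shows "zero_one_matrix A \<longleftrightarrow> (\<forall>i<a. \<forall>j<b. A $$ (i, j) \<le> 1)"
  by (fastforce simp: zero_one_matrix_def elements_mat_carrier[OF assms] le_Suc_eq)

section \<open>Essential and left-resolving graphs, treated column by column\<close>

lemma count_image_mset_inj':
  assumes "inj f"
  shows "count (image_mset f A) (f x) = count A x"
  by (induction A) (use assms in \<open>auto simp: inj_def\<close>)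

lemma image_mset_sum': "image_mset f (sum A I) = (\<Sum>i\<in>I. image_mset f (A i))"
  by (induction I rule: infinite_finite_induct) auto

text \<open>A symbol repeated in a column comes either from one entry, against essential, or from
  two rows, against left-resolving. Collecting the column in one multiset turns both into one bound
  on multiplicities, and \<open>column_sum_mult\<close> makes that bound compatible with
  products.\<close>

definition column_sum :: "'b::comm_monoid_add mat \<Rightarrow> nat \<Rightarrow> 'b" where
  "column_sum A j = (\<Sum>i<dim_row A. A $$ (i, j))"

text \<open>The graph of \<open>A\<close> is essential and left-resolving at the vertex \<open>j\<close>.\<close>

definition resolving_column :: "'a multiset mat \<Rightarrow> nat \<Rightarrow> bool" where
  "resolving_column A j \<longleftrightarrow> (\<forall>w. count (column_sum A j) w \<le> 1)"

lemma sum_le_one_iff: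
  fixes f :: "nat \<Rightarrow> nat"
  shows "(\<Sum>i<a. f i) \<le> 1 \<longleftrightarrow> (\<forall>i<a. f i \<le> 1) \<and> (\<forall>i<a. \<forall>i'<a. f i \<noteq> 0 \<and> f i' \<noteq> 0 \<longrightarrow> i = i')"
proof (induction a)
  case (Suc a)
  show ?case
  proof (cases "f a = 0")
    case True
    with Suc show ?thesis by (auto simp: less_Suc_eq)
  next
    case False
    have *: "x + y \<le> 1 \<longleftrightarrow> y = 1 \<and> x = 0" if "y \<noteq> 0" for x y :: nat
      using that by auto
    have "(\<Sum>i<Suc a. f i) \<le> 1 \<longleftrightarrow> f a = 1 \<and> (\<forall>i<a. f i = 0)"
      unfolding sum.lessThan_Suc *[OF False] by auto
    also have "\<dots> \<longleftrightarrow> (\<forall>i<Suc a. f i \<le> 1) \<and> (\<forall>i<Suc a. \<forall>i'<Suc a. f i \<noteq> 0 \<and> f i' \<noteq> 0 \<longrightarrow> i = i')"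
    proof
      assume R: "f a = 1 \<and> (\<forall>i<a. f i = 0)"
      then have "i = a" if "i < Suc a" "f i \<noteq> 0" for i
        using that by (auto simp: less_Suc_eq)
      moreover have "f i \<le> 1" if "i < Suc a" for i
        using R that by (cases "i = a") auto
      ultimately show "(\<forall>i<Suc a. f i \<le> 1) \<and> (\<forall>i<Suc a. \<forall>i'<Suc a. f i \<noteq> 0 \<and> f i' \<noteq> 0 \<longrightarrow> i = i')"
        by blast
    next
      assume L: "(\<forall>i<Suc a. f i \<le> 1) \<and> (\<forall>i<Suc a. \<forall>i'<Suc a. f i \<noteq> 0 \<and> f i' \<noteq> 0 \<longrightarrow> i = i')"
      then have "f a \<le> 1" by blast
      moreover have "f i = 0" if "i < a" for i
        using L False that by (metis less_SucI lessI less_irrefl)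
      ultimately show "f a = 1 \<and> (\<forall>i<a. f i = 0)"
        using False by auto
    qed
    finally show ?thesis .
  qed
qed simp

lemma resolving_column_iff:
  assumes "A \<in> carrier_mat a b"
  shows "resolving_column A j \<longleftrightarrow>
    (\<forall>i<a. \<forall>w. count (A $$ (i, j)) w \<le> 1) \<and>
    (\<forall>i<a. \<forall>i'<a. \<forall>w. w \<in># A $$ (i, j) \<and> w \<in># A $$ (i', j) \<longrightarrow> i = i')"
proof -
  have "count (column_sum A j) w \<le> 1 \<longleftrightarrow> (\<forall>i<a. count (A $$ (i, j)) w \<le> 1) \<and>
      (\<forall>i<a. \<forall>i'<a. w \<in># A $$ (i, j) \<and> w \<in># A $$ (i', j) \<longrightarrow> i = i')" for w
    using assms sum_le_one_iff[of "\<lambda>i. count (A $$ (i, j)) w" a]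
    by (simp add: column_sum_def count_sum)
  then show ?thesis unfolding resolving_column_def by blast
qed

lemma column_sum_mult:
  assumes "A \<in> carrier_mat a b" "B \<in> carrier_mat b c" "j < c"
  shows "column_sum (A * B) j = (\<Sum>h<b. column_sum A h * B $$ (h, j))"
proof -
  have "column_sum (A * B) j = (\<Sum>i<a. \<Sum>h<b. A $$ (i, h) * B $$ (h, j))"
    using assms unfolding column_sum_def by (auto simp: index_mult_sum[of _ a b _ c] simp del: index_mult_mat(1))
  also have "\<dots> = (\<Sum>h<b. column_sum A h * B $$ (h, j))"
    using assms by (subst sum.swap) (simp add: column_sum_def sum_distrib_right)
  finally show ?thesis .
qed

text \<open>With all words of \<open>U\<close> of length q, a product word can be cut only after its
  first q symbols, so a single pair of words contributes to the count.\<close>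

lemma count_times_le:
  fixes U V :: "'a list multiset"
  assumes "\<And>u. u \<in># U \<Longrightarrow> length u = q"
  shows "count (U * V) w \<le> count U (take q w) * count V (drop q w)"
  using assms
proof (induction U)
  case empty
  then show ?case by simp
next
  case (add u U)
  have "count (image_mset ((+) u) V) w \<le> (if u = take q w then count V (drop q w) else 0)"
  proof (cases "u = take q w")
    case True
    have "inj ((+) u)"
      by (auto simp: inj_def plus_list_def)
    moreover have "(+) u (drop q w) = w"
      by (simp add: True plus_list_def)
    ultimately show ?thesis
      using count_image_mset_inj'[of "(+) u" V "drop q w"] True by simp
  next
    case False
    then have "w \<notin># image_mset ((+) u) V"
      using add.prems[of u] by (auto simp: plus_list_def)
    then show ?thesis by (simp add: count_eq_zero_iff False)
  qed
  with add show ?case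
    by (auto simp: times_multiset_def)
qed

text \<open>Without a fixed length q, different cuts of one word could add up. With it, the bound 1
  on the columns of \<open>A\<close> leaves only the occurrences of \<open>drop q w\<close> in
  column j of \<open>B\<close>.\<close>

lemma resolving_column_mult:
  fixes A B :: "'a word_matrix"
  assumes "A \<in> carrier_mat a b" "B \<in> carrier_mat b c" "j < c"
    and len: "\<And>w. w \<in> symbols_of A \<Longrightarrow> length w = q"
    and A: "\<And>h. h < b \<Longrightarrow> resolving_column A h" and B: "resolving_column B j"
  shows "resolving_column (A * B) j"
  unfolding resolving_column_def
proof
  fix w
  have "count (column_sum (A * B) j) w \<le> (\<Sum>h<b. count (column_sum A h) (take q w) * count (B $$ (h, j)) (drop q w))"
    unfolding column_sum_mult[OF assms(1-3)] count_sum
    by (intro sum_mono count_times_le len)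
      (use assms(1) in \<open>auto simp: column_sum_def set_mset_sum symbols_of_carrier\<close>)
  also have "\<dots> \<le> (\<Sum>h<b. 1 * count (B $$ (h, j)) (drop q w))"
    using A by (intro sum_mono mult_right_mono) (auto simp: resolving_column_def)
  also have "\<dots> = count (column_sum B j) (drop q w)"
    using assms(2) by (simp add: column_sum_def count_sum)
  also have "\<dots> \<le> 1"
    using B by (simp add: resolving_column_def)
  finally show "count (column_sum (A * B) j) w \<le> 1" .
qed

text \<open>Cancellation: a word u repeated in column h of \<open>A\<close> would give the repeated
  word \<open>u @ v\<close> in column j of the product. It serves to deduce that \<open>P Y\<close>
  is resolving from a product that is easier to understand.\<close>

lemma resolving_column_mult_leftD:
  fixes A B :: "'a word_matrix"
  assumes "A \<in> carrier_mat a b" "B \<in> carrier_mat b c" "h < b" "j < c"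
    and AB: "resolving_column (A * B) j" and v: "v \<in># B $$ (h, j)"
  shows "resolving_column A h"
  unfolding resolving_column_def
proof
  fix u
  define U where "U = column_sum A h"
  obtain V where V: "B $$ (h, j) = add_mset v V"
    using v by (metis multi_member_split)
  have inj: "inj (\<lambda>u. u @ v)" by (auto simp: inj_def)
  have "count U u = count (U * {#v#}) (u @ v)"
    using count_image_mset_inj'[OF inj, of U u] by (simp add: times_multiset_def plus_list_def image_mset.compositionality)
  also have "\<dots> \<le> count (U * B $$ (h, j)) (u @ v)"
    unfolding V by (metis add_mset_add_single distrib_left count_union le_add2)
  also have "\<dots> \<le> (\<Sum>h<b. count (column_sum A h * B $$ (h, j)) (u @ v))"
    unfolding U_def using assms(3) by (intro member_le_sum) auto
  also have "\<dots> = count (column_sum (A * B) j) (u @ v)"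
    by (simp add: column_sum_mult[OF assms(1,2,4)] count_sum)
  also have "\<dots> \<le> 1"
    using AB by (simp add: resolving_column_def)
  finally show "count (column_sum A h) u \<le> 1" by (simp add: U_def)
qed

lemma resolving_column_map:
  assumes "A \<in> carrier_mat a b" "j < b" "resolving_column A j" "inj_on f (symbols_of A)"
  shows "resolving_column (map_mat (image_mset f) A) j"
proof -
  have sub: "set_mset (column_sum A j) \<subseteq> symbols_of A"
    using assms(1,2) by (auto simp: column_sum_def set_mset_sum symbols_of_carrier)
  have eq: "column_sum (map_mat (image_mset f) A) j = image_mset f (column_sum A j)"
    using assms(1,2) by (simp add: column_sum_def image_mset_sum')
  show ?thesis
    unfolding resolving_column_def eq
  proof
    fix y
    show "count (image_mset f (column_sum A j)) y \<le> 1"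
    proof (cases "y \<in># image_mset f (column_sum A j)")
      case True
      then obtain x where x: "x \<in># column_sum A j" "y = f x" by auto
      then have "f -` {y} \<inter> set_mset (column_sum A j) = {x}"
        using sub assms(4) by (auto simp: inj_on_def)
      then show ?thesis
        using assms(3) by (simp add: count_image_mset resolving_column_def)
    next
      case False
      then show ?thesis by (metis count_eq_zero_iff zero_le)
    qed
  qed
qed

lemma resolving_column_wd:
  assumes "A \<in> carrier_mat a b" "j < b" "resolving_column A j"
  shows "resolving_column (wd A) j"
  unfolding wd_def by (rule resolving_column_map[OF assms]) (auto simp: inj_on_def)

lemma resolving_column_zo:
  assumes "A \<in> carrier_mat a b" "j < b" "zero_one_matrix A"
    and "\<And>i i'. i < a \<Longrightarrow> i' < a \<Longrightarrow> A $$ (i, j) \<noteq> 0 \<Longrightarrow> A $$ (i', j) \<noteq> 0 \<Longrightarrow> i = i'"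
  shows "resolving_column (zo A :: 'a word_matrix) j"
proof -
  have "zo A \<in> carrier_mat a b" using assms(1) by simp
  then show ?thesis
    using assms
    by (auto simp: resolving_column_iff mem_zo[OF assms(1)] zero_one_matrix_carrier[OF assms(1)])
      (auto simp: zo_def of_nat_multiset zero_list_def)
qed

section \<open>Paths and rays in symbolic matrix systems\<close>

text \<open>The working form of the definition: being nonzero, unlike being 1, is described by
  intermediate vertices in a product of natural number matrices, and the last two clauses become
  \<open>resolving_column\<close>.\<close>

lemma symbolic_matrix_system_iff:
  "symbolic_matrix_system S \<longleftrightarrow>
    finite (alphabet S) \<and>
    (\<forall>l. sym_mat S l \<in> carrier_mat (msize S l) (msize S (Suc l))) \<and>
    (\<forall>l. symbolic_over (sym_mat S l) (alphabet S)) \<and>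
    (\<forall>l. inc_mat S l \<in> carrier_mat (msize S l) (msize S (Suc l))) \<and>
    (\<forall>l. zero_one_matrix (inc_mat S l)) \<and>
    (\<forall>l. zo (inc_mat S l) * wd (sym_mat S (Suc l)) = wd (sym_mat S l) * zo (inc_mat S (Suc l))) \<and>
    (\<forall>l. \<forall>i<msize S l. \<exists>j<msize S (Suc l). inc_mat S l $$ (i, j) \<noteq> 0) \<and>
    (\<forall>l. \<forall>j<msize S (Suc l). \<exists>!i. i < msize S l \<and> inc_mat S l $$ (i, j) \<noteq> 0) \<and>
    (\<forall>l. \<forall>i<msize S l. \<exists>j<msize S (Suc l). \<exists>a. a \<in># sym_mat S l $$ (i, j)) \<and>
    (\<forall>l. \<forall>j<msize S (Suc l). \<exists>i<msize S l. \<exists>a. a \<in># sym_mat S l $$ (i, j)) \<and>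
    (\<forall>l. \<forall>j<msize S (Suc l). resolving_column (sym_mat S l) j)"
proof -
  let ?C = "\<forall>l. inc_mat S l \<in> carrier_mat (msize S l) (msize S (Suc l))"
  let ?Z = "\<forall>l. zero_one_matrix (inc_mat S l)"
  have one: "inc_mat S l $$ (i, j) = 1 \<longleftrightarrow> inc_mat S l $$ (i, j) \<noteq> 0"
    if "?C" "?Z" "i < msize S l" "j < msize S (Suc l)" for l i j
    using that zero_one_matrix_carrier[of "inc_mat S l" "msize S l" "msize S (Suc l)"]
    by (fastforce simp: le_Suc_eq)
  have row: "(\<forall>l. \<forall>i<msize S l. \<exists>j<msize S (Suc l). inc_mat S l $$ (i, j) = 1) \<longleftrightarrow>
      (\<forall>l. \<forall>i<msize S l. \<exists>j<msize S (Suc l). inc_mat S l $$ (i, j) \<noteq> 0)" if "?C" "?Z"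
    using one[OF that] by (metis (no_types, lifting))
  have col: "(\<forall>l. \<forall>j<msize S (Suc l). \<exists>!i. i < msize S l \<and> inc_mat S l $$ (i, j) = 1) \<longleftrightarrow>
      (\<forall>l. \<forall>j<msize S (Suc l). \<exists>!i. i < msize S l \<and> inc_mat S l $$ (i, j) \<noteq> 0)" if "?C" "?Z"
    by (intro all_cong1 imp_cong refl arg_cong[where f = Ex1] ext) (use one[OF that] in blast)
  have ne: "A \<noteq> {#} \<longleftrightarrow> (\<exists>a. a \<in># A)" for A :: "'a multiset"
    by auto
  have res: "(\<forall>l. \<forall>i<msize S l. \<forall>j<msize S (Suc l). \<forall>a. count (sym_mat S l $$ (i, j)) a \<le> 1) \<and>
      (\<forall>l. \<forall>i<msize S l. \<forall>i'<msize S l. \<forall>j<msize S (Suc l). \<forall>a.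
        a \<in># sym_mat S l $$ (i, j) \<and> a \<in># sym_mat S l $$ (i', j) \<longrightarrow> i = i') \<longleftrightarrow>
      (\<forall>l. \<forall>j<msize S (Suc l). resolving_column (sym_mat S l) j)"
    if "\<forall>l. sym_mat S l \<in> carrier_mat (msize S l) (msize S (Suc l))"
    using resolving_column_iff[OF that[rule_format]] by meson
  let ?M = "\<forall>l. sym_mat S l \<in> carrier_mat (msize S l) (msize S (Suc l))"
  show ?thesis
  proof (cases "?M \<and> ?C \<and> ?Z")
    case True
    then have *: ?M ?C ?Z by blast+
    show ?thesis
      unfolding symbolic_matrix_system_def Let_def ne all_conj_distrib row[OF *(2,3)] col[OF *(2,3)] res[OF *(1)]
      by (simp only: conj_assoc)
  next
    \<comment> \<open>The clausewise equivalences above rely on shapes and 0-1 entries; these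
      clauses occur on both sides, so here both sides fail.\<close>
    case False
    show ?thesis
      unfolding symbolic_matrix_system_def Let_def all_conj_distrib
      by (rule iffI; elim conjE; rule FalseE; rule notE[OF False]; intro conjI; assumption)
  qed
qed

context
  fixes S :: "'a matrix_system"
  assumes sys: "symbolic_matrix_system S"
begin

lemmas sys_facts = sys[unfolded symbolic_matrix_system_iff]

lemma finite_alphabet: "finite (alphabet S)"
  and sym_carrier: "sym_mat S l \<in> carrier_mat (msize S l) (msize S (Suc l))"
  and sym_over: "symbols_of (sym_mat S l) \<subseteq> alphabet S"
  and inc_carrier: "inc_mat S l \<in> carrier_mat (msize S l) (msize S (Suc l))"
  and inc_zero_one: "zero_one_matrix (inc_mat S l)"
  and sym_inc_commute:
    "zo (inc_mat S l) * wd (sym_mat S (Suc l)) = wd (sym_mat S l) * zo (inc_mat S (Suc l))"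
  and inc_row: "i < msize S l \<Longrightarrow> \<exists>j<msize S (Suc l). inc_mat S l $$ (i, j) \<noteq> 0"
  and inc_column: "j < msize S (Suc l) \<Longrightarrow> \<exists>!i. i < msize S l \<and> inc_mat S l $$ (i, j) \<noteq> 0"
  and emits: "i < msize S l \<Longrightarrow> \<exists>j<msize S (Suc l). \<exists>a. a \<in># sym_mat S l $$ (i, j)"
  and receives: "j < msize S (Suc l) \<Longrightarrow> \<exists>i<msize S l. \<exists>a. a \<in># sym_mat S l $$ (i, j)"
  and sym_resolving: "j < msize S (Suc l) \<Longrightarrow> resolving_column (sym_mat S l) j"
  using sys_facts by (elim conjE; metis)+

lemma label_in_alphabet:
  assumes "i < msize S l" "j < msize S (Suc l)" "a \<in># sym_mat S l $$ (i, j)"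
  shows "a \<in> alphabet S"
  using sym_over[of l] assms by (auto simp: symbols_of_carrier[OF sym_carrier])

lemma inc_sym_commute_mem:
  assumes "i < msize S l" "j < msize S (Suc (Suc l))"
  shows "(\<exists>h<msize S (Suc l). inc_mat S l $$ (i, h) \<noteq> 0 \<and> a \<in># sym_mat S (Suc l) $$ (h, j)) \<longleftrightarrow>
    (\<exists>h<msize S (Suc l). a \<in># sym_mat S l $$ (i, h) \<and> inc_mat S (Suc l) $$ (h, j) \<noteq> 0)"
  using mem_zo_wd[OF inc_carrier sym_carrier assms, of "[a]"]
    mem_wd_zo[OF sym_carrier inc_carrier assms, of "[a]"]
  by (simp add: sym_inc_commute)

end

lemma labelled_path_bounds:
  "labelled_path S l i w j \<Longrightarrow> i < msize S l \<and> j < msize S (l + length w)"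
  by (induction w arbitrary: l i) (fastforce simp: labelled_path.simps)+

lemma labelled_path_append:
  "labelled_path S l i (u @ v) j \<longleftrightarrow>
    (\<exists>g. labelled_path S l i u g \<and> labelled_path S (l + length u) g v j)"
  by (induction u arbitrary: l i) (auto simp: labelled_path.simps dest: labelled_path_bounds)

definition admissible :: "'a matrix_system \<Rightarrow> nat \<Rightarrow> 'a list \<Rightarrow> bool" where
  "admissible S l w \<longleftrightarrow> (\<exists>i j. labelled_path S l i w j)"

text \<open>The nonzero entry says that g is the image of i under \<iota>. The local property copies
  the path edge by edge one level below, starting at g; its end is whatever results.\<close>

lemma labelled_path_down:
  assumes "symbolic_matrix_system S"
  shows "labelled_path S (Suc l) i w j \<Longrightarrow> g < msize S l \<Longrightarrow> inc_mat S l $$ (g, i) \<noteq> 0 \<Longrightarrow>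
    \<exists>h. labelled_path S l g w h"
proof (induction w arbitrary: l i g)
  case Nil
  then show ?case by (auto simp: labelled_path.simps)
next
  case (Cons a w)
  then obtain i' where i': "i' < msize S (Suc (Suc l))" "a \<in># sym_mat S (Suc l) $$ (i, i')"
      "labelled_path S (Suc (Suc l)) i' w j" "i < msize S (Suc l)"
    by (auto simp: labelled_path.simps)
  then obtain g' where g': "g' < msize S (Suc l)" "a \<in># sym_mat S l $$ (g, g')"
      "inc_mat S (Suc l) $$ (g', i') \<noteq> 0"
    using inc_sym_commute_mem[OF assms, of g l i' a] Cons.prems by auto
  then show ?case
    using Cons.IH[OF i'(3) g'(1,3)] Cons.prems(2) by (auto simp: labelled_path.simps)
qed

text \<open>The lift is built from the end backwards: any vertex h above the terminal j can be
  prescribed, and the start is some vertex above i.\<close>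

lemma labelled_path_up:
  assumes "symbolic_matrix_system S"
  shows "labelled_path S l i w j \<Longrightarrow> h < msize S (Suc (l + length w)) \<Longrightarrow>
    inc_mat S (l + length w) $$ (j, h) \<noteq> 0 \<Longrightarrow>
    \<exists>g<msize S (Suc l). inc_mat S l $$ (i, g) \<noteq> 0 \<and> labelled_path S (Suc l) g w h"
proof (induction w arbitrary: l i)
  case Nil
  then show ?case by (auto simp: labelled_path.simps)
next
  case (Cons a w)
  then obtain i' where i': "i' < msize S (Suc l)" "a \<in># sym_mat S l $$ (i, i')"
      "labelled_path S (Suc l) i' w j" "i < msize S l"
    by (auto simp: labelled_path.simps)
  then obtain g' where g': "g' < msize S (Suc (Suc l))" "inc_mat S (Suc l) $$ (i', g') \<noteq> 0"
      "labelled_path S (Suc (Suc l)) g' w h"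
    using Cons.IH[OF i'(3)] Cons.prems by auto
  then obtain g where "g < msize S (Suc l)" "inc_mat S l $$ (i, g) \<noteq> 0"
      "a \<in># sym_mat S (Suc l) $$ (g, g')"
    using inc_sym_commute_mem[OF assms i'(4) g'(1), of a] i' by auto
  then show ?case
    using g' by (auto simp: labelled_path.simps)
qed

text \<open>Going down needs that every vertex has an image under \<iota>, going up that \<iota> is
  onto. Hence the level in the definition of the presented subshift can be chosen at will.\<close>

lemma admissible_level:
  assumes "symbolic_matrix_system S"
  shows "admissible S l w \<longleftrightarrow> admissible S l' w"
proof -
  have "admissible S (Suc l) w \<longleftrightarrow> admissible S l w" for l
  proof
    assume "admissible S (Suc l) w"
    then show "admissible S l w"
      unfolding admissible_def
      by (metis assms labelled_path_down inc_column labelled_path_bounds)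
  next
    assume "admissible S l w"
    then show "admissible S (Suc l) w"
      unfolding admissible_def
      by (metis assms labelled_path_up inc_row labelled_path_bounds)
  qed
  then have "admissible S l w \<longleftrightarrow> admissible S 0 w" for l
    by (induction l) auto
  then show ?thesis by blast
qed

section \<open>One-sided sequences read along infinite paths\<close>

definition segment :: "(int \<Rightarrow> 'a) \<Rightarrow> nat \<Rightarrow> 'a list" where
  "segment x n = map (\<lambda>t. x (int t)) [0..<n]"

definition translate :: "int \<Rightarrow> (int \<Rightarrow> 'a) \<Rightarrow> int \<Rightarrow> 'a" where
  "translate p x = (\<lambda>i. x (p + i))"

definition agree_from :: "int \<Rightarrow> (int \<Rightarrow> 'a) \<Rightarrow> (int \<Rightarrow> 'a) \<Rightarrow> bool" where
  "agree_from a x y \<longleftrightarrow> (\<forall>i\<ge>a. x i = y i)"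

text \<open>The path is allowed to vary with n; that its edges can be chosen coherently is the
  content of \<open>ray_Suc\<close>.\<close>

definition ray :: "'a matrix_system \<Rightarrow> nat \<Rightarrow> nat \<Rightarrow> (int \<Rightarrow> 'a) \<Rightarrow> bool" where
  "ray S l i x \<longleftrightarrow> (\<forall>n. \<exists>j. labelled_path S l i (segment x n) j)"

lemma segment_0 [simp]: "segment x 0 = []"
  by (simp add: segment_def)

lemma length_segment [simp]: "length (segment x n) = n"
  by (simp add: segment_def)

lemma segment_snoc: "segment x (Suc n) = segment x n @ [x (int n)]"
  by (simp add: segment_def)

lemma segment_Suc: "segment x (Suc n) = x 0 # segment (shift x) n"
  by (induction n) (simp_all add: segment_snoc shift_def add.commute)

lemma segment_agree: "agree_from 0 x y \<Longrightarrow> segment x n = segment y n"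
  by (simp add: segment_def agree_from_def)

lemma translate_translate: "translate p (translate r x) = translate (p + r) x"
  by (simp add: translate_def ac_simps)

lemma translate_0 [simp]: "translate 0 x = x"
  by (simp add: translate_def)

lemma shift_eq_translate: "shift = translate 1"
  by (simp add: fun_eq_iff shift_def translate_def add.commute)

lemma presented_subshift_iff:
  "x \<in> presented_subshift S \<longleftrightarrow> (\<forall>p n. \<exists>l. admissible S l (segment (translate p x) n))"
  by (simp add: presented_subshift_def admissible_def segment_def translate_def)

lemma ray_bound: "ray S l i x \<Longrightarrow> i < msize S l"
  using labelled_path_bounds unfolding ray_def by blast

lemma ray_agree: "agree_from 0 x y \<Longrightarrow> ray S l i x \<longleftrightarrow> ray S l i y"
  by (simp add: ray_def segment_agree)

text \<open>Koenig's lemma in one step: if each candidate u failed at some stage \<open>b u\<close>,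
  then by monotonicity all of the finitely many candidates would fail at the largest of these
  stages.\<close>

lemma uniform_witness:
  assumes "finite A" and ex: "\<And>n::nat. \<exists>u\<in>A. P n u" and anti: "\<And>n u. P (Suc n) u \<Longrightarrow> P n u"
  shows "\<exists>u\<in>A. \<forall>n. P n u"
proof (rule ccontr)
  assume "\<not> ?thesis"
  then obtain b where b: "\<And>u. u \<in> A \<Longrightarrow> \<not> P (b u) u" by metis
  have mono: "P n u" if "P m u" "n \<le> m" for m n u
    using that(2,1) by (induction rule: dec_induct) (auto intro: anti)
  obtain u where "u \<in> A" "P (Max (b ` A)) u" using ex by blast
  then show False using b mono[of "Max (b ` A)" u "b u"] assms(1) by simp
qed

lemma ray_iff_admissible: "(\<exists>i. ray S l i x) \<longleftrightarrow> (\<forall>n. admissible S l (segment x n))"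
proof
  assume *: "\<forall>n. admissible S l (segment x n)"
  have "\<exists>i\<in>{..<msize S l}. \<forall>n. \<exists>j. labelled_path S l i (segment x n) j"
  proof (rule uniform_witness)
    show "\<exists>i\<in>{..<msize S l}. \<exists>j. labelled_path S l i (segment x n) j" for n
      using * labelled_path_bounds unfolding admissible_def by blast
  qed (auto simp: segment_snoc labelled_path_append)
  then show "\<exists>i. ray S l i x" by (auto simp: ray_def)
qed (use admissible_def ray_def in blast)

lemma ray_level:
  assumes "symbolic_matrix_system S" "ray S l i x"
  obtains i' where "ray S l' i' x"
  using assms admissible_level[OF assms(1), of l _ l'] ray_iff_admissible[of S l x] ray_iff_admissible[of S l' x]
  by blast

lemma subshift_iff_ray:
  assumes "symbolic_matrix_system S"
  shows "x \<in> presented_subshift S \<longleftrightarrow> (\<forall>p. \<exists>i. ray S l i (translate p x))"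
  unfolding presented_subshift_iff ray_iff_admissible using admissible_level[OF assms] by blast

lemma subshiftI_ray:
  assumes "\<And>p. \<exists>l i. ray S l i (translate p x)"
  shows "x \<in> presented_subshift S"
  unfolding presented_subshift_iff using assms ray_iff_admissible by metis

text \<open>The terminal u of the first edge may a priori depend on the length of the path, but
  there are only finitely many vertices in the next level, so one u serves all lengths.\<close>

lemma ray_Suc:
  "ray S l i x \<longleftrightarrow> i < msize S l \<and>
    (\<exists>u<msize S (Suc l). x 0 \<in># sym_mat S l $$ (i, u) \<and> ray S (Suc l) u (shift x))"
proof
  assume *: "ray S l i x"
  have "\<exists>u\<in>{..<msize S (Suc l)}. \<forall>n. x 0 \<in># sym_mat S l $$ (i, u) \<and>
      (\<exists>j. labelled_path S (Suc l) u (segment (shift x) n) j)"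
  proof (rule uniform_witness)
    fix n
    from * obtain j where "labelled_path S l i (segment x (Suc n)) j"
      by (auto simp: ray_def)
    then show "\<exists>u\<in>{..<msize S (Suc l)}. x 0 \<in># sym_mat S l $$ (i, u) \<and>
      (\<exists>j. labelled_path S (Suc l) u (segment (shift x) n) j)"
      by (auto simp: segment_Suc labelled_path.simps)
  qed (auto simp: segment_snoc labelled_path_append)
  then show "i < msize S l \<and>
    (\<exists>u<msize S (Suc l). x 0 \<in># sym_mat S l $$ (i, u) \<and> ray S (Suc l) u (shift x))"
    using ray_bound[OF *] by (auto simp: ray_def)
next
  assume *: "i < msize S l \<and>
    (\<exists>u<msize S (Suc l). x 0 \<in># sym_mat S l $$ (i, u) \<and> ray S (Suc l) u (shift x))"
  show "ray S l i x"
    unfolding ray_def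
  proof
    fix n
    show "\<exists>j. labelled_path S l i (segment x n) j"
    proof (cases n)
      case 0
      with * show ?thesis by (auto simp: labelled_path.simps)
    next
      case (Suc m)
      with * show ?thesis by (simp add: labelled_path.simps ray_def segment_Suc) blast
    qed
  qed
qed

lemma ray_translate:
  assumes "ray S l i x"
  obtains u where "ray S (l + n) u (translate (int n) x)"
proof -
  have "\<exists>u. ray S (l + n) u (translate (int n) x)"
  proof (induction n)
    case 0
    then show ?case using assms by auto
  next
    case (Suc n)
    then show ?case
      using ray_Suc[of S "l + n" _ "translate (int n) x"]
      by (auto simp: shift_eq_translate translate_translate)
  qed
  with that show ?thesis by blast
qed

lemma ray_exists:
  assumes "symbolic_matrix_system S" "i < msize S l"
  obtains x where "ray S l i x"
proof -
  have "\<exists>f. \<forall>n. (f n < msize S (l + n) \<and> (n = 0 \<longrightarrow> f n = i)) \<and>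
      (\<exists>a. a \<in># sym_mat S (l + n) $$ (f n, f (Suc n)))"
    by (rule dependent_nat_choice) (use assms emits[OF assms(1)] in auto)
  then obtain f where f: "\<And>n. f n < msize S (l + n)" "f 0 = i"
      "\<And>n. \<exists>a. a \<in># sym_mat S (l + n) $$ (f n, f (Suc n))"
    by blast
  from f(3) obtain a where a: "\<And>n. a n \<in># sym_mat S (l + n) $$ (f n, f (Suc n))"
    by metis
  have "labelled_path S l i (segment (\<lambda>t. a (nat t)) n) (f n)" for n
  proof (induction n)
    case 0
    then show ?case using assms(2) f(2) by (auto simp: labelled_path.simps)
  next
    case (Suc n)
    then show ?case
      using a[of n] f(1)[of n] f(1)[of "Suc n"]
      by (auto simp: segment_snoc labelled_path_append labelled_path.simps)
  qed
  then have "ray S l i (\<lambda>t. a (nat t))" by (auto simp: ray_def)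
  with that show ?thesis .
qed

text \<open>No edge ends at level 0, so the ray is first moved to a vertex of level 1, where an
  incoming edge supplies the symbol to prepend.\<close>

lemma ray_extend_left:
  assumes "symbolic_matrix_system S" "ray S 0 i x"
  shows "\<exists>y. (\<exists>i. ray S 0 i y) \<and> agree_from 0 (shift y) x"
proof -
  obtain v where v: "ray S 1 v x" using ray_level assms by blast
  then obtain g a where ga: "g < msize S 0" "a \<in># sym_mat S 0 $$ (g, v)"
    using receives[OF assms(1), of v 0] ray_bound by fastforce
  define y where "y = (\<lambda>t. if t = 0 then a else x (t - 1))"
  have y: "y 0 = a" "agree_from 0 (shift y) x"
    by (auto simp: y_def shift_def agree_from_def)
  then have "ray S 0 g y"
    using ga v ray_bound[OF v] ray_agree[OF y(2)] by (auto simp: ray_Suc[of S 0])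
  with y show ?thesis by blast
qed

text \<open>Symbols are prepended for ever by dependent choice; \<open>f s\<close> is the sequence
  after s of them. Only the nonnegative half of x survives, which is all that a ray
  controls.\<close>

lemma ray_extends_to_point:
  assumes "symbolic_matrix_system S" "ray S l i x"
  obtains y where "y \<in> presented_subshift S" "agree_from 0 y x"
proof -
  obtain i0 where i0: "ray S 0 i0 x" using ray_level assms by blast
  have "\<exists>f. \<forall>n. ((\<exists>i. ray S 0 i (f n)) \<and> (n = 0 \<longrightarrow> f n = x)) \<and>
      agree_from 0 (shift (f (Suc n))) (f n)"
    by (rule dependent_nat_choice) (use i0 ray_extend_left[OF assms(1)] in auto)
  then obtain f where f: "\<And>n. \<exists>i. ray S 0 i (f n)" "f 0 = x"
      "\<And>n. agree_from 0 (shift (f (Suc n))) (f n)"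
    by blast
  \<comment> \<open>Position t of the limit has index t + s in \<open>f s\<close>. The least s that
    makes this index nonnegative is taken; later extensions do not change the value.\<close>
  define y where "y = (\<lambda>t. f (nat (- t)) (t + int (nat (- t))))"
  have y: "y t = f s (t + int s)" if "t \<ge> - int s" for s t
    using that
  proof (induction s)
    case 0
    then show ?case by (simp add: y_def)
  next
    case (Suc s)
    show ?case
    proof (cases "t \<ge> - int s")
      case True
      with Suc.IH f(3)[of s] show ?thesis
        by (simp add: agree_from_def shift_def) (metis add.assoc le_add_same_cancel2 add.commute neg_le_iff_le
            diff_ge_0_iff_ge diff_minus_eq_add)
    next
      case False
      with Suc.prems have "t = - int (Suc s)" by simp
      then show ?thesis by (simp add: y_def nat_add_distrib)
    qed
  qed
  have "y \<in> presented_subshift S"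
  proof (rule subshiftI_ray)
    fix p
    define s where "s = nat (- p)"
    obtain i where "ray S 0 i (f s)" using f(1) by blast
    then obtain u where u: "ray S (0 + nat (p + int s)) u (translate (int (nat (p + int s))) (f s))"
      by (rule ray_translate)
    have "agree_from 0 (translate p y) (translate (int (nat (p + int s))) (f s))"
      using y[of s] by (auto simp: agree_from_def translate_def s_def ac_simps)
    with u show "\<exists>l i. ray S l i (translate p y)"
      using ray_agree by blast
  qed
  moreover have "agree_from 0 y x"
    using f(2) by (auto simp: agree_from_def y_def)
  ultimately show ?thesis by (rule that)
qed

lemma translate_presented: "x \<in> presented_subshift S \<Longrightarrow> translate p x \<in> presented_subshift S"
  by (simp add: presented_subshift_iff translate_translate)

lemma bij_betw_shift: "bij_betw shift (presented_subshift S) (presented_subshift S)"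
  by (rule bij_betw_byWitness[where f' = "translate (-1)"])
    (auto simp: shift_eq_translate translate_translate translate_presented)

section \<open>The topology of sequence spaces\<close>

lemma topspace_shift_topology [simp]: "topspace (shift_topology L) = L"
  by (simp add: shift_topology_def)

lemma Hausdorff_shift_topology: "Hausdorff_space (shift_topology L)"
  by (simp add: shift_topology_def Hausdorff_space_subtopology Hausdorff_space_product_topology)

lemma continuous_map_coordinate:
  "continuous_map (shift_topology L) (discrete_topology UNIV) (\<lambda>x. x i)"
  unfolding shift_topology_def
  by (intro continuous_map_from_subtopology continuous_map_product_projection) simp

lemma continuous_map_shift_topologyI:
  assumes "\<And>i. continuous_map (shift_topology L) (discrete_topology UNIV) (\<lambda>x. f x i)"
    and "\<And>x. x \<in> L \<Longrightarrow> f x \<in> L'"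
  shows "continuous_map (shift_topology L) (shift_topology L') f"
  unfolding shift_topology_def[of L'] continuous_map_in_subtopology continuous_map_componentwise_UNIV
  using assms by auto

text \<open>A product of two discrete spaces is discrete, so G is automatically continuous. This
  covers block maps such as the step map, which looks at two neighbouring symbols.\<close>

lemma continuous_map_discrete2:
  assumes "continuous_map X (discrete_topology UNIV) f" "continuous_map X (discrete_topology UNIV) g"
  shows "continuous_map X (discrete_topology UNIV) (\<lambda>x. G (f x) (g x))"
proof -
  have "continuous_map X (discrete_topology UNIV) (\<lambda>x. (f x, g x))"
    using continuous_map_pairedI[OF assms]
    by (simp flip: prod_topology_discrete_topology)
  from continuous_map_compose[OF this, of "discrete_topology UNIV" "\<lambda>(a, b). G a b"]
  show ?thesis by (simp add: o_def continuous_map_def)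
qed

lemma continuous_map_segment:
  "continuous_map (shift_topology L) (discrete_topology UNIV) (\<lambda>x. segment (translate p x) n)"
proof (induction n)
  case 0
  then show ?case by simp
next
  case (Suc n)
  from continuous_map_discrete2[OF Suc continuous_map_coordinate[of L "p + int n"], of "\<lambda>w a. w @ [a]"]
  show ?case by (simp add: segment_snoc translate_def)
qed

lemma compact_presented_subshift:
  assumes "symbolic_matrix_system S"
  shows "compact_space (shift_topology (presented_subshift S))"
proof -
  define X :: "(int \<Rightarrow> 'a) topology" where "X = shift_topology UNIV"
  have X: "X = product_topology (\<lambda>_. discrete_topology UNIV) UNIV"
    by (simp add: X_def shift_topology_def)
  have "compactin X (PiE UNIV (\<lambda>_. alphabet S))"
    unfolding X compactin_PiE using finite_alphabet[OF assms]
    by (auto simp: compactin_discrete_topology)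
  moreover have "presented_subshift S \<subseteq> PiE UNIV (\<lambda>_. alphabet S)"
  proof
    fix x assume x: "x \<in> presented_subshift S"
    have "x p \<in> alphabet S" for p
    proof -
      obtain i where "ray S 0 i (translate p x)"
        using x subshift_iff_ray[OF assms] by blast
      then show ?thesis
        using label_in_alphabet[OF assms] by (auto simp: ray_Suc[of S 0] translate_def)
    qed
    then show "x \<in> PiE UNIV (\<lambda>_. alphabet S)" by auto
  qed
  moreover have "closedin X (presented_subshift S)"
  proof -
    \<comment> \<open>Since admissibility does not depend on the level, the existential level can be
      fixed to 0, and the set becomes an intersection of preimages under continuous maps into a
      discrete space.\<close>
    have "presented_subshift S =
        (\<Inter>pn. {x \<in> topspace X. segment (translate (fst pn) x) (snd pn) \<in> {w. admissible S 0 w}})"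
      by (auto simp: presented_subshift_iff X_def) (use admissible_level[OF assms] in blast)+
    also have "closedin X \<dots>"
      unfolding X_def
      by (intro closedin_INT closedin_continuous_map_preimage[OF continuous_map_segment]) auto
    finally show ?thesis .
  qed
  ultimately have "compactin X (presented_subshift S)"
    by (rule closed_compactin)
  then show ?thesis
    by (simp add: shift_topology_def X compact_space_subtopology)
qed

section \<open>Transfers between symbolic matrix systems\<close>

text \<open>Following an edge of \<open>F\<close> reads off the word \<open>g x\<close> from a sequence \<open>x\<close>, leaves \<open>f x\<close> and
  leads \<open>q\<close> levels up; \<open>e\<close> is the number of symbols of \<open>x\<close> that are lost in \<open>f x\<close>. The columns of
  \<open>F 0\<close> may vanish, but not those of \<open>F 0\<close> times a letter matrix: this is what \<open>exchange\<close> is for.\<close>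

locale transfer =
  fixes S S' :: "'a matrix_system" and q e :: nat
    and F :: "nat \<Rightarrow> 'a word_matrix"
    and f :: "(int \<Rightarrow> 'a) \<Rightarrow> int \<Rightarrow> 'a"
    and g :: "(int \<Rightarrow> 'a) \<Rightarrow> 'a list"
  assumes source: "symbolic_matrix_system S"
    and target: "symbolic_matrix_system S'"
    and carrier: "F l \<in> carrier_mat (msize S l) (msize S' (l + q))"
    and word_length: "w \<in> symbols_of (F l) \<Longrightarrow> length w = q"
    and finite_words: "finite (\<Union>l. symbols_of (F l))"
    and inc_commute: "zo (inc_mat S l) * F (Suc l) = F l * zo (inc_mat S' (l + q))"
    and resolving: "j < msize S' (l + q) \<Longrightarrow> resolving_column (F l) j"
    and row: "i < msize S l \<Longrightarrow> \<exists>j<msize S' (l + q). \<exists>w. w \<in># F l $$ (i, j)"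
    and column: "j < msize S' (Suc (l + q)) \<Longrightarrow>
      \<exists>i<msize S (Suc l). \<exists>w. w \<in># F (Suc l) $$ (i, j)"
    and exchange: "\<lbrakk>h < msize S l; v < msize S (Suc l); u < msize S' (Suc (l + q));
        a \<in># sym_mat S l $$ (h, v); w \<in># F (Suc l) $$ (v, u)\<rbrakk> \<Longrightarrow>
      \<exists>v'<msize S' (l + q). \<exists>w' a'. w' \<in># F l $$ (h, v') \<and> a' \<in># sym_mat S' (l + q) $$ (v', u)"
    and forward: "ray S l i x \<Longrightarrow> \<exists>u<msize S' (l + q). g x \<in># F l $$ (i, u) \<and> ray S' (l + q) u (f x)"
    and backward: "\<lbrakk>i < msize S l; u < msize S' (l + q); w \<in># F l $$ (i, u); ray S' (l + q) u z\<rbrakk> \<Longrightarrow>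
      \<exists>x. ray S l i x \<and> g x = w \<and> agree_from 0 (f x) z"
    and label_agree: "agree_from 0 x y \<Longrightarrow> g x = g y"
    and map_agree: "agree_from p x y \<Longrightarrow> agree_from (p - int e) (f x) (f y)"
    and recover: "\<lbrakk>x \<in> presented_subshift S; y \<in> presented_subshift S; g x = g y;
        segment (f x) m = segment (f y) m\<rbrakk> \<Longrightarrow> segment x (m + e) = segment y (m + e)"
    and bij: "bij_betw f (presented_subshift S) (presented_subshift S')"
    and continuous:
      "continuous_map (shift_topology (presented_subshift S)) (shift_topology (presented_subshift S')) f"
    and continuous_label:
      "continuous_map (shift_topology (presented_subshift S)) (discrete_topology UNIV) g"

text \<open>The second transfer reads from \<open>f x\<close> and starts q levels higher; levels,
  words and lost symbols add up. The fixed lengths of the words make the cut of a concatenation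
  unique.\<close>

lemma transfer_compose:
  assumes "transfer S S' q e F f g" "transfer S' S'' q' e' F' f' g'"
  shows "transfer S S'' (q + q') (e + e') (\<lambda>l. F l * F' (l + q)) (f' \<circ> f) (\<lambda>x. g x @ g' (f x))"
proof -
  interpret A: transfer S S' q e F f g by fact
  interpret B: transfer S' S'' q' e' F' f' g' by fact
  have B_carrier: "F' (l + q) \<in> carrier_mat (msize S' (l + q)) (msize S'' (l + (q + q')))" for l
    using B.carrier[of "l + q"] by (simp add: add.assoc)
  note mem = mem_mult_mat[OF A.carrier B_carrier]
  show ?thesis
  proof (rule transfer.intro, goal_cases)
    case 1 show ?case by (rule A.source)
  next
    case 2 show ?case by (rule B.target)
  next
    case (3 l) show ?case using A.carrier B_carrier by (rule mult_carrier_mat)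
  next
    case (4 w l)
    from symbols_of_mult[OF A.carrier B_carrier this] obtain u v
      where "u \<in> symbols_of (F l)" "v \<in> symbols_of (F' (l + q))" "w = u @ v" .
    then show ?case using A.word_length B.word_length by simp
  next
    case 5
    have "(\<Union>l. symbols_of (F l * F' (l + q))) \<subseteq>
        (\<lambda>(u, v). u @ v) ` ((\<Union>l. symbols_of (F l)) \<times> (\<Union>l. symbols_of (F' l)))"
      by (auto elim!: symbols_of_mult[OF A.carrier B_carrier])
    then show ?case
      by (rule finite_subset) (intro finite_imageI finite_cartesian_product A.finite_words B.finite_words)
  next
    case (6 l)
    have I: "zo (inc_mat S l) \<in> carrier_mat (msize S l) (msize S (Suc l))"
      "zo (inc_mat S' (l + q)) \<in> carrier_mat (msize S' (l + q)) (msize S' (Suc l + q))"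
      "zo (inc_mat S'' (l + (q + q'))) \<in> carrier_mat (msize S'' (l + (q + q'))) (msize S'' (Suc l + (q + q')))"
      using inc_carrier[OF A.source] inc_carrier[OF A.target] inc_carrier[OF B.target] by auto
    have B': "zo (inc_mat S' (l + q)) * F' (Suc l + q) = F' (l + q) * zo (inc_mat S'' (l + (q + q')))"
      using B.inc_commute[of "l + q"] by (simp add: add.assoc)
    have "zo (inc_mat S l) * (F (Suc l) * F' (Suc l + q)) =
        (F l * zo (inc_mat S' (l + q))) * F' (Suc l + q)"
      by (simp only: assoc_mult_mat[OF I(1) A.carrier B_carrier, symmetric] A.inc_commute)
    also have "\<dots> = F l * F' (l + q) * zo (inc_mat S'' (l + (q + q')))"
      by (simp only: assoc_mult_mat[OF A.carrier I(2) B_carrier] B'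
          assoc_mult_mat[OF A.carrier B_carrier I(3)])
    finally show ?case .
  next
    case (7 j l)
    show ?case
      using 7 B.resolving[of j "l + q"]
      by (intro resolving_column_mult[OF A.carrier B_carrier _ A.word_length A.resolving])
        (auto simp: add.assoc)
  next
    case (8 i l)
    obtain h u where "h < msize S' (l + q)" "u \<in># F l $$ (i, h)"
      using A.row[OF 8] by blast
    with B.row[of h "l + q"] 8 show ?case
      by (fastforce simp: mem add.assoc simp del: index_mult_mat(1))
  next
    case (9 j l)
    obtain h v where h: "h < msize S' (Suc l + q)" "v \<in># F' (Suc l + q) $$ (h, j)"
      using B.column[of j "l + q"] 9 by (auto simp: add.assoc)
    with A.column[of h l] obtain i u where "i < msize S (Suc l)" "u \<in># F (Suc l) $$ (i, h)"
      by auto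
    with h 9 show ?case
      using mem[of i "Suc l" j] by (metis add_Suc)
  next
    \<comment> \<open>The letter edge is pushed first past the factor in \<open>F\<close>, then, as
      a letter edge of the middle system, past the factor in \<open>F'\<close>.\<close>
    case (10 h l v u a w)
    then obtain v1 w1 w2 where 1: "v1 < msize S' (Suc (l + q))" "w1 \<in># F (Suc l) $$ (v, v1)"
        "w2 \<in># F' (Suc (l + q)) $$ (v1, u)"
      using mem[of v "Suc l" u w] by auto
    then obtain v2 w1' a1 where 2: "v2 < msize S' (l + q)" "w1' \<in># F l $$ (h, v2)"
        "a1 \<in># sym_mat S' (l + q) $$ (v2, v1)"
      using A.exchange[of h l v v1 a w1] 10 by blast
    then obtain v3 w2' a2 where 3: "v3 < msize S'' (l + (q + q'))" "w2' \<in># F' (l + q) $$ (v2, v3)"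
        "a2 \<in># sym_mat S'' (l + (q + q')) $$ (v3, u)"
      using B.exchange[of v2 "l + q" v1 u a1 w2] 1 10(3) by (auto simp: add.assoc)
    then have "w1' @ w2' \<in># (F l * F' (l + q)) $$ (h, v3)"
      using 2 10(1) by (auto simp: mem simp del: index_mult_mat(1))
    with 3 show ?case by blast
  next
    case (11 l i x)
    then obtain v where v: "v < msize S' (l + q)" "g x \<in># F l $$ (i, v)" "ray S' (l + q) v (f x)"
      using A.forward by blast
    with B.forward[of "l + q" v "f x"] obtain u where u: "u < msize S'' (l + (q + q'))"
        "g' (f x) \<in># F' (l + q) $$ (v, u)" "ray S'' (l + (q + q')) u (f' (f x))"
      by (auto simp: add.assoc)
    moreover have "g x @ g' (f x) \<in># (F l * F' (l + q)) $$ (i, u)"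
      using mem[OF ray_bound[OF 11] u(1)] v u by blast
    ultimately show ?case by auto
  next
    case (12 i l u w z)
    then obtain v w1 w2 where v: "v < msize S' (l + q)" "w1 \<in># F l $$ (i, v)"
        "w2 \<in># F' (l + q) $$ (v, u)" "w = w1 @ w2"
      by (auto simp: mem simp del: index_mult_mat(1))
    with B.backward[of v "l + q" u w2 z] 12 obtain y where y: "ray S' (l + q) v y" "g' y = w2"
        "agree_from 0 (f' y) z"
      by (auto simp: add.assoc)
    with A.backward[OF 12(1) v(1,2)] obtain x where x: "ray S l i x" "g x = w1" "agree_from 0 (f x) y"
      by blast
    then have "g' (f x) = w2"
      using B.label_agree y by metis
    \<comment> \<open>Losing symbols moves the start of agreement to the left, so agreement from 0
      is preserved in particular.\<close>
    moreover have "agree_from 0 (f' (f x)) (f' y)"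
      using B.map_agree[OF x(3)] by (auto simp: agree_from_def)
    then have "agree_from 0 (f' (f x)) z"
      using y(3) by (simp add: agree_from_def)
    ultimately show ?case
      using x v(4) by auto
  next
    case (13 x y)
    have "agree_from 0 (f x) (f y)"
      using A.map_agree[OF 13] by (auto simp: agree_from_def)
    then show ?case
      using A.label_agree[OF 13] B.label_agree by simp
  next
    case (14 p x y)
    show ?case
      using B.map_agree[OF A.map_agree[OF 14]] by (simp add: algebra_simps)
  next
    case (15 x y m)
    have fx: "f x \<in> presented_subshift S'" "f y \<in> presented_subshift S'"
      using A.bij 15 by (auto dest: bij_betwE)
    \<comment> \<open>Both first words have length q, so equality of the concatenations splits into
      equality of the two parts.\<close>
    obtain i where "ray S 0 i x" using 15(1) subshift_iff_ray[OF A.source] translate_0 by metis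
    then have "length (g x) = q"
      using A.forward[of 0 i x] A.carrier[of 0] ray_bound[of S 0 i x] A.word_length[of _ 0]
      by (auto simp: symbols_of_carrier)
    moreover obtain i' where "ray S 0 i' y" using 15(2) subshift_iff_ray[OF A.source] translate_0 by metis
    then have "length (g y) = q"
      using A.forward[of 0 i' y] A.carrier[of 0] ray_bound[of S 0 i' y] A.word_length[of _ 0]
      by (auto simp: symbols_of_carrier)
    ultimately have g: "g x = g y" "g' (f x) = g' (f y)"
      using 15(3) by auto
    have "segment x (m + e' + e) = segment y (m + e' + e)"
      using 15(4) by (intro A.recover[OF 15(1,2) g(1)] B.recover[OF fx g(2)]) simp
    then show ?case by (simp only: add.assoc add.commute[of e])
  next
    case 16 show ?case using A.bij B.bij by (rule bij_betw_trans)
  next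
    case 17 show ?case using A.continuous B.continuous by (rule continuous_map_compose)
  next
    case 18
    show ?case
      using continuous_map_compose[OF A.continuous B.continuous_label]
      unfolding o_def by (rule continuous_map_discrete2[OF A.continuous_label, where G = "(@)"])
  qed
qed

lemma mem_one_mat: "i < a \<Longrightarrow> j < a \<Longrightarrow> w \<in># (1\<^sub>m a :: 'a word_matrix) $$ (i, j) \<longleftrightarrow> i = j \<and> w = []"
  by (simp add: one_multiset_def zero_list_def)

lemma symbols_of_one_mat: "w \<in> symbols_of (1\<^sub>m a :: 'a word_matrix) \<Longrightarrow> w = []"
  using symbols_of_carrier[of "1\<^sub>m a :: 'a word_matrix" a a]
  by (auto simp: mem_one_mat simp del: index_one_mat)

text \<open>The start of both inductions below: the empty chain and the power k = 0.\<close>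

lemma transfer_id:
  assumes sys: "symbolic_matrix_system S"
  shows "transfer S S 0 0 (\<lambda>l. 1\<^sub>m (msize S l)) id (\<lambda>_. [])"
proof (rule transfer.intro, goal_cases)
  case (4 w l)
  then show ?case by (simp add: symbols_of_one_mat)
next
  case 5
  have "(\<Union>l. symbols_of (1\<^sub>m (msize S l) :: 'a word_matrix)) \<subseteq> {[]}"
    using symbols_of_one_mat by blast
  then show ?case by (rule finite_subset) simp
next
  case (6 l)
  have "zo (inc_mat S l) \<in> carrier_mat (msize S l) (msize S (Suc l))"
    using inc_carrier[OF sys] by simp
  then show ?case by simp
next
  case (7 j l)
  have "resolving_column (zo (1\<^sub>m (msize S l)) :: 'a word_matrix) j"
    by (rule resolving_column_zo[of _ "msize S l" "msize S l"])
      (use 7 in \<open>auto simp: zero_one_matrix_carrier[of _ "msize S l" "msize S l"] split: if_splits\<close>)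
  then show ?case by (simp add: zo_one)
next
  case (10 h l v u a w)
  then show ?case by (auto simp: mem_one_mat simp del: index_one_mat)
next
  case (11 l i x)
  then show ?case using ray_bound[OF 11] by (auto simp: mem_one_mat simp del: index_one_mat)
next
  case 17
  show ?case by (simp add: id_def)
qed (use sys in \<open>auto simp: mem_one_mat agree_from_def ray_bound simp del: index_one_mat\<close>)

lemma transfer_letter:
  assumes sys: "symbolic_matrix_system S"
  shows "transfer S S 1 1 (\<lambda>l. wd (sym_mat S l)) shift (\<lambda>x. [x 0])"
proof -
  note mem = mem_wd[OF sym_carrier[OF sys]]
  have *: "wd (sym_mat S l) \<in> carrier_mat (msize S l) (msize S (Suc l))" for l
    using sym_carrier[OF sys] by simp
  note symb = symbols_of_carrier[OF *]
  show ?thesis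
  proof (rule transfer.intro, goal_cases)
    case (4 w l)
    then show ?case by (auto simp: symb mem)
  next
    case 5
    have "(\<Union>l. symbols_of (wd (sym_mat S l))) \<subseteq> (\<lambda>a. [a]) ` alphabet S"
      by (auto simp: symb mem intro!: imageI label_in_alphabet[OF sys])
    then show ?case by (rule finite_subset) (simp add: finite_alphabet[OF sys])
  next
    case (6 l)
    show ?case using sym_inc_commute[OF sys] by simp
  next
    case (7 j l)
    then show ?case
      using resolving_column_wd[OF sym_carrier[OF sys], of j l] sym_resolving[OF sys] by simp
  next
    case (8 i l)
    obtain j a where "j < msize S (Suc l)" "a \<in># sym_mat S l $$ (i, j)"
      using emits[OF sys 8] by blast
    then show ?case using mem[OF 8, of j "[a]"] by auto
  next
    case (9 j l)
    then have j: "j < msize S (Suc (Suc l))" by simp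
    obtain i a where "i < msize S (Suc l)" "a \<in># sym_mat S (Suc l) $$ (i, j)"
      using receives[OF sys j] by blast
    then show ?case using mem[of i "Suc l" j "[a]"] j by auto
  next
    case (10 h l v u a w)
    then obtain b where "b \<in># sym_mat S (Suc l) $$ (v, u)" by (auto simp: mem)
    with 10 show ?case using mem[of h l v "[a]"] by auto
  next
    case (11 l i x)
    then obtain u where "u < msize S (Suc l)" "x 0 \<in># sym_mat S l $$ (i, u)" "ray S (Suc l) u (shift x)"
      by (auto simp: ray_Suc[of S l i])
    then show ?case using mem[OF ray_bound[OF 11], of u "[x 0]"] by auto
  next
    case (12 i l u w z)
    then obtain a where a: "w = [a]" "a \<in># sym_mat S l $$ (i, u)" by (auto simp: mem)
    define x where "x = (\<lambda>t. if t = 0 then a else z (t - 1))"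
    have x: "x 0 = a" "agree_from 0 (shift x) z"
      by (auto simp: x_def shift_def agree_from_def)
    then have "ray S l i x"
      using 12 a ray_agree[OF x(2)] by (auto simp: ray_Suc[of S l i])
    with x a show ?case by auto
  next
    case (15 x y m)
    then show ?case by (simp add: segment_Suc)
  next
    case 16 show ?case by (rule bij_betw_shift)
  next
    case 17
    show ?case
      by (rule continuous_map_shift_topologyI)
        (auto simp: shift_def continuous_map_coordinate intro: bij_betw_apply[OF bij_betw_shift, unfolded shift_def])
  next
    case 18
    show ?case
      by (rule continuous_map_discrete2[OF continuous_map_coordinate[where i = 0]
            continuous_map_coordinate[where i = 0], where G = "\<lambda>a b. [a]"])
  qed (use sys * in \<open>auto simp: agree_from_def shift_def\<close>)
qed

section \<open>The transfer of a one-step equivalence\<close>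

text \<open>A one-step equivalence is symmetric under this exchange, so each fact about
  \<open>P\<close> and \<open>X\<close> yields one about \<open>Q\<close> and \<open>Y\<close>.
  Moreover the dual step map inverts the step map up to the shift.\<close>

definition dual_data :: "'a psse_data \<Rightarrow> 'a psse_data" where
  "dual_data E = \<lparr>alphC = alphD E, alphD = alphC E, kappa0 = kappa1 E, kappa1 = kappa0 E,
     matP = matQ E, matQ = matP E, matX = matY E, matY = matX E\<rparr>"

lemma dual_data_simps [simp]:
  "alphC (dual_data E) = alphD E" "alphD (dual_data E) = alphC E"
  "kappa0 (dual_data E) = kappa1 E" "kappa1 (dual_data E) = kappa0 E"
  "matP (dual_data E) = matQ E" "matQ (dual_data E) = matP E"
  "matX (dual_data E) = matY E" "matY (dual_data E) = matX E"
  "dual_data (dual_data E) = E"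
  by (simp_all add: dual_data_def)

lemma step_map_eq:
  "step_map E x i = (THE a. kappa1 E a = Some [the (kappa0 E (x i)) ! 1, the (kappa0 E (x (i + 1))) ! 0])"
  by (simp add: step_map_def apply_spec_inv_def zeta_plus_def apply_spec_def)

text \<open>The relation \<open>X P = P Y\<close> is used twice, each time lowering the index of
  \<open>P\<close> by one: X X P Y = X P Y Y = P Y Y Y.\<close>

lemma mult_mat_exchange:
  fixes x0 :: "'b::semiring_1 mat"
  assumes "x0 \<in> carrier_mat a0 a1" "x1 \<in> carrier_mat a1 a2"
    and "p0 \<in> carrier_mat a0 b1" "p1 \<in> carrier_mat a1 b2" "p2 \<in> carrier_mat a2 b3"
    and "y1 \<in> carrier_mat b1 b2" "y2 \<in> carrier_mat b2 b3" "y3 \<in> carrier_mat b3 b4"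
    and "x0 * p1 = p0 * y1" "x1 * p2 = p1 * y2"
  shows "(x0 * x1) * (p2 * y3) = (p0 * y1) * (y2 * y3)"
proof -
  have "(x0 * x1) * (p2 * y3) = x0 * (x1 * (p2 * y3))"
    by (rule assoc_mult_mat[OF assms(1,2) mult_carrier_mat[OF assms(5,8)]])
  also have "x1 * (p2 * y3) = p1 * (y2 * y3)"
    by (simp only: assms(10) assoc_mult_mat[OF assms(2,5,8), symmetric] assoc_mult_mat[OF assms(4,7,8)])
  also have "x0 * \<dots> = (x0 * p1) * (y2 * y3)"
    by (rule assoc_mult_mat[OF assms(1,4) mult_carrier_mat[OF assms(7,8)], symmetric])
  finally show ?thesis by (simp only: assms(9))
qed

locale one_step =
  fixes E :: "'a psse_data" and S S' :: "'a matrix_system"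
  assumes equivalence: "psse_one_step E S S'"
    and source: "symbolic_matrix_system S"
    and target: "symbolic_matrix_system S'"
begin

text \<open>These are the sequences n and n' of the definition, recovered as row numbers so that
  they need not be carried along as existential witnesses.\<close>

abbreviation "rP l \<equiv> dim_row (matP E l)"
abbreviation "rQ l \<equiv> dim_row (matQ E l)"

lemma dual: "one_step (dual_data E) S' S"
proof
  show "psse_one_step (dual_data E) S' S"
    using equivalence unfolding psse_one_step_def Let_def dual_data_simps by blast
qed (rule source target)+

lemma carriers:
  shows P_carrier: "matP E l \<in> carrier_mat (rP l) (rQ (Suc l))"
    and Q_carrier: "matQ E l \<in> carrier_mat (rQ l) (rP (Suc l))"
    and X_carrier: "matX E l \<in> carrier_mat (rP l) (rP (Suc l))"
    and Y_carrier: "matY E l \<in> carrier_mat (rQ l) (rQ (Suc l))"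
    and P_over: "symbols_of (matP E l) \<subseteq> alphC E"
    and X_zero_one: "zero_one_matrix (matX E l)"
proof -
  obtain n n' where n: "\<And>l. matP E l \<in> carrier_mat (n l) (n' (Suc l)) \<and> symbols_of (matP E l) \<subseteq> alphC E \<and>
      matQ E l \<in> carrier_mat (n' l) (n (Suc l)) \<and> symbols_of (matQ E l) \<subseteq> alphD E \<and>
      matX E l \<in> carrier_mat (n l) (n (Suc l)) \<and> zero_one_matrix (matX E l) \<and>
      matY E l \<in> carrier_mat (n' l) (n' (Suc l)) \<and> zero_one_matrix (matY E l)"
    using equivalence unfolding psse_one_step_def Let_def by blast
  then have "n = rP" "n' = rQ"
    by (auto simp: fun_eq_iff) (metis carrier_matD(1))+
  with n show "matP E l \<in> carrier_mat (rP l) (rQ (Suc l))" "matQ E l \<in> carrier_mat (rQ l) (rP (Suc l))"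
    "matX E l \<in> carrier_mat (rP l) (rP (Suc l))" "matY E l \<in> carrier_mat (rQ l) (rQ (Suc l))"
    "symbols_of (matP E l) \<subseteq> alphC E" "zero_one_matrix (matX E l)"
    by auto
qed

lemma equations:
  shows PQ: "wd (matP E (2 * l)) * wd (matQ E (Suc (2 * l))) =
      map_mat (image_mset (\<lambda>a. the (kappa0 E a))) (sym_mat S l)"
    and dom_kappa0: "symbols_of (sym_mat S l) \<subseteq> dom (kappa0 E)"
    and inc_eq: "inc_mat S l = matX E (2 * l) * matX E (Suc (2 * l))"
    and XP: "zo (matX E l) * wd (matP E (Suc l)) = wd (matP E l) * zo (matY E (Suc l))"
    and finite_C: "finite (alphC E)"
    and inj_kappa0: "inj_on (kappa0 E) (dom (kappa0 E))"
  using equivalence unfolding psse_one_step_def Let_def spec_equivalent_def specification_map_def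
  by auto

lemma rP_even: "rP (2 * l) = msize S l"
  using arg_cong[OF PQ[of l], of dim_row] by (simp add: wd_def msize_def)

lemma rP_Suc_even: "rP (Suc (Suc (2 * l))) = msize S (Suc l)"
  using rP_even[of "Suc l"] by simp

lemma XP_mem:
  assumes "i < rP l" "j < rQ (Suc (Suc l))"
  shows "(\<exists>h<rP (Suc l). matX E l $$ (i, h) \<noteq> 0 \<and> c \<in># matP E (Suc l) $$ (h, j)) \<longleftrightarrow>
    (\<exists>h<rQ (Suc l). c \<in># matP E l $$ (i, h) \<and> matY E (Suc l) $$ (h, j) \<noteq> 0)"
  using mem_zo_wd[OF X_carrier P_carrier assms, of "[c]"]
    mem_wd_zo[OF P_carrier Y_carrier assms, of "[c]"]
  by (simp add: XP)

lemma kappa0_inj: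
  assumes "kappa0 E a = Some y" "kappa0 E b = Some y"
  shows "a = b"
  using inj_onD[OF inj_kappa0, of a b] assms by auto

lemma the_kappa0: "kappa0 E a = Some y \<Longrightarrow> (THE a. kappa0 E a = Some y) = a"
  using kappa0_inj by blast

text \<open>An edge of M splits at an intermediate vertex into a \<open>P\<close> edge labelled c
  and a \<open>Q\<close> edge labelled d. As \<open>kappa0\<close> is partial,
  \<open>dom_kappa0\<close> is what turns \<open>the (kappa0 E a)\<close> back into a genuine
  value.\<close>

lemma
  assumes "i < msize S l" "j < msize S (Suc l)"
  shows factor: "a \<in># sym_mat S l $$ (i, j) \<Longrightarrow> \<exists>c d. kappa0 E a = Some [c, d] \<and>
      (\<exists>h<rQ (Suc (2 * l)). c \<in># matP E (2 * l) $$ (i, h) \<and> d \<in># matQ E (Suc (2 * l)) $$ (h, j))"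
    and unfactor: "\<lbrakk>h < rQ (Suc (2 * l)); c \<in># matP E (2 * l) $$ (i, h); d \<in># matQ E (Suc (2 * l)) $$ (h, j)\<rbrakk> \<Longrightarrow>
      \<exists>a. a \<in># sym_mat S l $$ (i, j) \<and> kappa0 E a = Some [c, d]"
proof -
  have c: "matP E (2 * l) \<in> carrier_mat (msize S l) (rQ (Suc (2 * l)))"
    "matQ E (Suc (2 * l)) \<in> carrier_mat (rQ (Suc (2 * l))) (msize S (Suc l))"
    using P_carrier[of "2 * l"] Q_carrier[of "Suc (2 * l)"] unfolding rP_even rP_Suc_even .
  note mem = mem_wd_wd[OF c assms]
  have entry: "(wd (matP E (2 * l)) * wd (matQ E (Suc (2 * l)))) $$ (i, j) =
      image_mset (\<lambda>a. the (kappa0 E a)) (sym_mat S l $$ (i, j))"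
    unfolding PQ using sym_carrier[OF source, of l] assms by simp
  have dom: "a \<in> dom (kappa0 E)" if "a \<in># sym_mat S l $$ (i, j)" for a
    using that dom_kappa0[of l] assms by (auto simp: symbols_of_carrier[OF sym_carrier[OF source]])
  {
    assume a: "a \<in># sym_mat S l $$ (i, j)"
    then have "the (kappa0 E a) \<in># (wd (matP E (2 * l)) * wd (matQ E (Suc (2 * l)))) $$ (i, j)"
      by (simp add: entry)
    then obtain h c d where h: "h < rQ (Suc (2 * l))" "the (kappa0 E a) = [c, d]"
        "c \<in># matP E (2 * l) $$ (i, h)" "d \<in># matQ E (Suc (2 * l)) $$ (h, j)"
      unfolding mem by blast
    then have "kappa0 E a = Some [c, d]"
      using dom[OF a] by (metis domD option.sel)
    with h show "\<exists>c d. kappa0 E a = Some [c, d] \<and>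
      (\<exists>h<rQ (Suc (2 * l)). c \<in># matP E (2 * l) $$ (i, h) \<and> d \<in># matQ E (Suc (2 * l)) $$ (h, j))"
      by blast
  }
  {
    assume "h < rQ (Suc (2 * l))" "c \<in># matP E (2 * l) $$ (i, h)" "d \<in># matQ E (Suc (2 * l)) $$ (h, j)"
    then have "[c, d] \<in># image_mset (\<lambda>a. the (kappa0 E a)) (sym_mat S l $$ (i, j))"
      unfolding entry[symmetric] mem by blast
    then obtain a where "a \<in># sym_mat S l $$ (i, j)" "[c, d] = the (kappa0 E a)" by auto
    with dom[of a] show "\<exists>a. a \<in># sym_mat S l $$ (i, j) \<and> kappa0 E a = Some [c, d]"
      by (metis domD option.sel)
  }
qed

lemma inc_nonzero:
  assumes "i < msize S l" "j < msize S (Suc l)"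
  shows "inc_mat S l $$ (i, j) \<noteq> 0 \<longleftrightarrow>
    (\<exists>h<rP (Suc (2 * l)). matX E (2 * l) $$ (i, h) \<noteq> 0 \<and> matX E (Suc (2 * l)) $$ (h, j) \<noteq> 0)"
  unfolding inc_eq
  by (rule nat_mult_mat_nonzero[OF X_carrier[of "2 * l", unfolded rP_even]
        X_carrier[of "Suc (2 * l)", unfolded rP_Suc_even] assms])

lemma X_even_row:
  assumes "i < msize S l"
  shows "\<exists>h<rP (Suc (2 * l)). matX E (2 * l) $$ (i, h) \<noteq> 0"
  using inc_row[OF source assms] inc_nonzero[OF assms] by blast

end

text \<open>The locale context is reopened below whenever the facts proved so far are needed for the dual
  equivalence as well: an interpretation only provides the facts known when it is issued.\<close>

context one_step
begin

interpretation D: one_step "dual_data E" S' S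
  by (rule dual)

lemmas rQ_even = D.rP_even[simplified]
lemmas YQ = D.XP[simplified]
lemmas YQ_mem = D.XP_mem[simplified dual_data_simps]
lemmas factor' = D.factor[simplified dual_data_simps]
lemmas unfactor' = D.unfactor[simplified dual_data_simps]
lemmas Y_even_row = D.X_even_row[simplified dual_data_simps]
lemmas inc_nonzero' = D.inc_nonzero[simplified dual_data_simps]
lemmas inc_eq' = D.inc_eq[simplified dual_data_simps]
lemmas the_kappa1 = D.the_kappa0[simplified dual_data_simps]

text \<open>The product X X of an incidence matrix says nothing about intermediate rows that are not
  reached. An outgoing \<open>P\<close> edge helps: its end w has a successor under the even matrix
  \<open>Y\<close>, and \<open>P Y = X P\<close> turns this into a successor of h.\<close>

lemma X_odd_row:
  assumes "h < rP (Suc (2 * l))" "w < msize S' (Suc l)" "c \<in># matP E (Suc (2 * l)) $$ (h, w)"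
  shows "\<exists>v<msize S (Suc l). matX E (Suc (2 * l)) $$ (h, v) \<noteq> 0"
proof -
  obtain w' where "w' < rQ (Suc (2 * Suc l))" "matY E (2 * Suc l) $$ (w, w') \<noteq> 0"
    using Y_even_row[OF assms(2)] by blast
  then have "\<exists>v<rP (2 * Suc l). matX E (Suc (2 * l)) $$ (h, v) \<noteq> 0 \<and> c \<in># matP E (2 * Suc l) $$ (v, w')"
    using XP_mem[of h "Suc (2 * l)" w' c] assms rQ_even[of "Suc l"] by auto
  then show ?thesis unfolding rP_even by blast
qed

end

context one_step
begin

interpretation D: one_step "dual_data E" S' S
  by (rule dual)

lemmas Y_odd_row = D.X_odd_row[simplified dual_data_simps]

section \<open>Edges of the product P Y and their exchange with letters\<close>

definition transfer_matrix :: "nat \<Rightarrow> 'a word_matrix" where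
  "transfer_matrix l = wd (matP E (2 * l)) * zo (matY E (Suc (2 * l)))"

definition edge :: "nat \<Rightarrow> nat \<Rightarrow> 'a \<Rightarrow> nat \<Rightarrow> bool" where
  "edge l i c j \<longleftrightarrow> (\<exists>h<rQ (Suc (2 * l)). c \<in># matP E (2 * l) $$ (i, h) \<and> matY E (Suc (2 * l)) $$ (h, j) \<noteq> 0)"

lemma P_even_carrier: "matP E (2 * l) \<in> carrier_mat (msize S l) (rQ (Suc (2 * l)))"
  using P_carrier[of "2 * l"] by (simp add: rP_even)

lemma Y_odd_carrier: "matY E (Suc (2 * l)) \<in> carrier_mat (rQ (Suc (2 * l))) (msize S' (Suc l))"
  using Y_carrier[of "Suc (2 * l)"] rQ_even[of "Suc l"] by simp

lemma transfer_matrix_carrier: "transfer_matrix l \<in> carrier_mat (msize S l) (msize S' (Suc l))"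
  unfolding transfer_matrix_def
  by (rule mult_carrier_mat[where n = "rQ (Suc (2 * l))"]) (simp_all add: P_even_carrier Y_odd_carrier)

lemma mem_transfer_matrix:
  assumes "i < msize S l" "j < msize S' (Suc l)"
  shows "w \<in># transfer_matrix l $$ (i, j) \<longleftrightarrow> (\<exists>c. w = [c] \<and> edge l i c j)"
  unfolding transfer_matrix_def mem_wd_zo[OF P_even_carrier Y_odd_carrier assms] edge_def by blast

text \<open>The local form of \<zeta>: (c d) c' is regrouped as c (d c'). First
  \<open>P Y = X P\<close> lifts c' past index 2l+2, then \<open>Q X = Y Q\<close> lifts d past
  index 2l+1, after which d and c' are adjacent and form a letter of M'.\<close>

lemma edge_exchange:
  assumes "i < msize S l" "v < msize S (Suc l)" "j < msize S' (Suc (Suc l))"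
    and a: "a \<in># sym_mat S l $$ (i, v)" and e: "edge (Suc l) v c' j"
  shows "\<exists>u<msize S' (Suc l). \<exists>a' c d. kappa0 E a = Some [c, d] \<and> edge l i c u \<and>
    a' \<in># sym_mat S' (Suc l) $$ (u, j) \<and> kappa1 E a' = Some [d, c']"
proof -
  obtain c d h where 1: "kappa0 E a = Some [c, d]" "h < rQ (Suc (2 * l))"
      "c \<in># matP E (2 * l) $$ (i, h)" "d \<in># matQ E (Suc (2 * l)) $$ (h, v)"
    using factor[OF assms(1,2) a] by blast
  obtain f where 2: "f < rP (Suc (2 * Suc l))" "matX E (2 * Suc l) $$ (v, f) \<noteq> 0"
      "c' \<in># matP E (Suc (2 * Suc l)) $$ (f, j)"
    using e XP_mem[of v "2 * Suc l" j c'] assms(2,3) rP_even[of "Suc l"] rQ_even[of "Suc (Suc l)"]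
    unfolding edge_def by auto
  obtain u where 3: "u < rQ (2 * Suc l)" "matY E (Suc (2 * l)) $$ (h, u) \<noteq> 0"
      "d \<in># matQ E (2 * Suc l) $$ (u, f)"
    using YQ_mem[of h "Suc (2 * l)" f d] 1 2 assms(2) rP_even[of "Suc l"] by auto
  then have u: "u < msize S' (Suc l)" using rQ_even[of "Suc l"] by simp
  obtain a' where "a' \<in># sym_mat S' (Suc l) $$ (u, j)" "kappa1 E a' = Some [d, c']"
    using unfactor'[OF u assms(3) 2(1) 3(3) 2(3)] by blast
  with u 1 3 show ?thesis unfolding edge_def by blast
qed

lemma edge_exchange_back:
  assumes "i < msize S l" "u < msize S' (Suc l)" "j < msize S' (Suc (Suc l))"
    and e: "edge l i c u" and a': "a' \<in># sym_mat S' (Suc l) $$ (u, j)"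
  shows "\<exists>v<msize S (Suc l). \<exists>a c' d. kappa1 E a' = Some [d, c'] \<and> edge (Suc l) v c' j \<and>
    a \<in># sym_mat S l $$ (i, v) \<and> kappa0 E a = Some [c, d]"
proof -
  obtain d c' f where 1: "kappa1 E a' = Some [d, c']" "f < rP (Suc (2 * Suc l))"
      "d \<in># matQ E (2 * Suc l) $$ (u, f)" "c' \<in># matP E (Suc (2 * Suc l)) $$ (f, j)"
    using factor'[OF assms(2,3) a'] by blast
  obtain h where 2: "h < rQ (Suc (2 * l))" "c \<in># matP E (2 * l) $$ (i, h)"
      "matY E (Suc (2 * l)) $$ (h, u) \<noteq> 0"
    using e unfolding edge_def by blast
  obtain v where 3: "v < rP (2 * Suc l)" "d \<in># matQ E (Suc (2 * l)) $$ (h, v)"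
      "matX E (2 * Suc l) $$ (v, f) \<noteq> 0"
    using YQ_mem[of h "Suc (2 * l)" f d] 1 2 assms(2) rQ_even[of "Suc l"] by auto
  then have v: "v < msize S (Suc l)" using rP_even[of "Suc l"] by simp
  obtain a where "a \<in># sym_mat S l $$ (i, v)" "kappa0 E a = Some [c, d]"
    using unfactor[OF assms(1) v 2(1,2) 3(2)] by blast
  moreover have "edge (Suc l) v c' j"
    using XP_mem[of v "2 * Suc l" j c'] 1 3 assms(3) rQ_even[of "Suc (Suc l)"]
    unfolding edge_def by auto
  ultimately show ?thesis using v 1 by blast
qed

text \<open>The intermediate vertex of the factored letter emits the \<open>Q\<close> edge d, so the
  dual of \<open>X_odd_row\<close> continues c by a nonzero entry of \<open>Y\<close>.\<close>

lemma edge_exists: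
  assumes "i < msize S l" "v < msize S (Suc l)" "a \<in># sym_mat S l $$ (i, v)"
  shows "\<exists>u<msize S' (Suc l). \<exists>c d. kappa0 E a = Some [c, d] \<and> edge l i c u"
proof -
  obtain c d h where 1: "kappa0 E a = Some [c, d]" "h < rQ (Suc (2 * l))"
      "c \<in># matP E (2 * l) $$ (i, h)" "d \<in># matQ E (Suc (2 * l)) $$ (h, v)"
    using factor[OF assms] by blast
  obtain u where "u < msize S' (Suc l)" "matY E (Suc (2 * l)) $$ (h, u) \<noteq> 0"
    using Y_odd_row[OF 1(2) assms(2) 1(4)] by blast
  with 1 have "edge l i c u" unfolding edge_def by blast
  with 1 \<open>u < _\<close> show ?thesis by blast
qed

text \<open>The image v of j under \<iota> lies one level lower and must receive a letter edge,
  hence the successor level. The \<open>P\<close> half of that edge, moved up along the first factor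
  of the incidence matrix, gives the required edge into j.\<close>

lemma transfer_matrix_column:
  assumes "j < msize S' (Suc (Suc l))"
  shows "\<exists>i<msize S (Suc l). \<exists>c. edge (Suc l) i c j"
proof -
  obtain v where v: "v < msize S' (Suc l)" "inc_mat S' (Suc l) $$ (v, j) \<noteq> 0"
    using inc_column[OF target assms] by blast
  then obtain f where f: "f < rQ (Suc (2 * Suc l))" "matY E (2 * Suc l) $$ (v, f) \<noteq> 0"
      "matY E (Suc (2 * Suc l)) $$ (f, j) \<noteq> 0"
    using inc_nonzero'[OF v(1) assms] by blast
  obtain u a where u: "u < msize S' l" "a \<in># sym_mat S' l $$ (u, v)"
    using receives[OF target v(1)] by blast
  then obtain h c where h: "h < rP (Suc (2 * l))" "c \<in># matP E (Suc (2 * l)) $$ (h, v)"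
    using factor'[OF u(1) v(1)] by blast
  then obtain i where "i < rP (2 * Suc l)" "c \<in># matP E (2 * Suc l) $$ (i, f)"
    using XP_mem[of h "Suc (2 * l)" f c] f v rQ_even[of "Suc l"] by auto
  then show ?thesis
    using f rP_even[of "Suc l"] unfolding edge_def by auto
qed

lemma transfer_matrix_inc:
  "zo (inc_mat S l) * transfer_matrix (Suc l) = transfer_matrix l * zo (inc_mat S' (Suc l))"
proof -
  let ?k = "2 * l"
  have *: "2 * Suc l = Suc (Suc ?k)" by simp
  have I: "zo (inc_mat S l) = zo (matX E ?k) * zo (matX E (Suc ?k))"
    unfolding inc_eq by (rule zo_mult[OF X_carrier X_carrier])
  have I': "zo (inc_mat S' (Suc l)) = zo (matY E (Suc (Suc ?k))) * zo (matY E (Suc (Suc (Suc ?k))))"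
    unfolding inc_eq' * by (rule zo_mult[OF Y_carrier Y_carrier])
  show ?thesis
    unfolding I I' transfer_matrix_def *
    by (rule mult_mat_exchange[OF _ _ _ _ _ _ _ _ XP XP]; unfold zo_carrier wd_carrier;
        rule X_carrier Y_carrier P_carrier)
qed

lemma inj_the_kappa0: "inj_on (\<lambda>a. the (kappa0 E a)) (symbols_of (sym_mat S l))"
proof (rule inj_onI)
  fix a b
  assume "a \<in> symbols_of (sym_mat S l)" "b \<in> symbols_of (sym_mat S l)"
    and eq: "the (kappa0 E a) = the (kappa0 E b)"
  then obtain y z where "kappa0 E a = Some y" "kappa0 E b = Some z"
    using dom_kappa0[of l] by blast
  with eq show "a = b" using kappa0_inj by simp
qed

text \<open>Multiplying by \<open>Q\<close> gives (P Y) Q = (P Q) X, where P Q is a relabelling of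
  M. The right side is resolving in a suitable column h, and \<open>Q\<close> is cancelled by
  \<open>resolving_column_mult_leftD\<close>.\<close>

lemma transfer_matrix_resolving:
  assumes j: "j < msize S' (Suc l)"
  shows "resolving_column (transfer_matrix l) j"
proof -
  let ?K = "map_mat (image_mset (\<lambda>a. the (kappa0 E a))) (sym_mat S l)"
  let ?k = "2 * l"
  have *: "2 * Suc l = Suc (Suc ?k)" by simp
  \<comment> \<open>An edge leaving j provides the entry of \<open>Q\<close> to be cancelled and the
    column h; h has a successor u under the odd \<open>X\<close>.\<close>
  obtain v b where v: "v < msize S' (Suc (Suc l))" "b \<in># sym_mat S' (Suc l) $$ (j, v)"
    using emits[OF target j] by blast
  obtain d c h where h: "h < rP (Suc (2 * Suc l))" "d \<in># matQ E (2 * Suc l) $$ (j, h)"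
      "c \<in># matP E (Suc (2 * Suc l)) $$ (h, v)"
    using factor'[OF j v] by blast
  obtain u where u: "u < msize S (Suc (Suc l))" "matX E (Suc (2 * Suc l)) $$ (h, u) \<noteq> 0"
    using X_odd_row[OF h(1) v(1) h(3)] by blast
  have K: "?K \<in> carrier_mat (msize S l) (msize S (Suc l))"
    using sym_carrier[OF source, of l] by simp
  have X: "matX E (2 * Suc l) \<in> carrier_mat (msize S (Suc l)) (rP (Suc (2 * Suc l)))"
    using X_carrier[of "2 * Suc l"] unfolding rP_even .
  then have zX: "zo (matX E (2 * Suc l)) \<in> carrier_mat (msize S (Suc l)) (rP (Suc (2 * Suc l)))"
    by simp
  have zY: "zo (matY E (Suc ?k)) \<in> carrier_mat (rQ (Suc ?k)) (msize S' (Suc l))"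
    using Y_odd_carrier by simp
  have wQ: "wd (matQ E (2 * Suc l)) \<in> carrier_mat (msize S' (Suc l)) (rP (Suc (2 * Suc l)))"
    using Q_carrier[of "2 * Suc l"] unfolding wd_carrier rQ_even .
  have wQ1: "wd (matQ E (Suc ?k)) \<in> carrier_mat (rQ (Suc ?k)) (msize S (Suc l))"
    using Q_carrier[of "Suc ?k"] unfolding wd_carrier rP_Suc_even .
  have wP: "wd (matP E ?k) \<in> carrier_mat (msize S l) (rQ (Suc ?k))"
    using P_even_carrier by simp
  have "transfer_matrix l * wd (matQ E (2 * Suc l)) = wd (matP E ?k) * (zo (matY E (Suc ?k)) * wd (matQ E (2 * Suc l)))"
    unfolding transfer_matrix_def by (rule assoc_mult_mat[OF wP zY wQ])
  also have "zo (matY E (Suc ?k)) * wd (matQ E (2 * Suc l)) = wd (matQ E (Suc ?k)) * zo (matX E (2 * Suc l))"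
    using YQ[of "Suc ?k"] unfolding * .
  also have "wd (matP E ?k) * \<dots> = ?K * zo (matX E (2 * Suc l))"
    unfolding assoc_mult_mat[OF wP wQ1 zX, symmetric] PQ ..
  finally have eq: "transfer_matrix l * wd (matQ E (2 * Suc l)) = ?K * zo (matX E (2 * Suc l))" .
  \<comment> \<open>Two vertices above h in column h of \<open>X\<close> would both be images of u
    under \<iota>.\<close>
  have "resolving_column (zo (matX E (2 * Suc l)) :: 'a word_matrix) h"
  proof (rule resolving_column_zo[OF X h(1) X_zero_one])
    fix i i'
    assume "i < msize S (Suc l)" "i' < msize S (Suc l)" "matX E (2 * Suc l) $$ (i, h) \<noteq> 0" "matX E (2 * Suc l) $$ (i', h) \<noteq> 0"
    then have "inc_mat S (Suc l) $$ (i, u) \<noteq> 0" "inc_mat S (Suc l) $$ (i', u) \<noteq> 0"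
      using inc_nonzero u h(1) by blast+
    then show "i = i'"
      using inc_column[OF source u(1)] \<open>i < _\<close> \<open>i' < _\<close> by blast
  qed
  moreover have "length w = 2" if "w \<in> symbols_of ?K" for w
  proof -
    from that obtain i j where ij: "i < msize S l" "j < msize S (Suc l)"
        "w \<in># ?K $$ (i, j)"
      by (subst (asm) symbols_of_carrier[OF K]) blast
    then obtain a where "a \<in># sym_mat S l $$ (i, j)" "w = the (kappa0 E a)"
      using sym_carrier[OF source, of l] by auto
    then show ?thesis using factor[OF ij(1,2)] by fastforce
  qed
  moreover have "resolving_column ?K i" if "i < msize S (Suc l)" for i
    by (rule resolving_column_map[OF sym_carrier[OF source] that sym_resolving[OF source that] inj_the_kappa0])
  ultimately have "resolving_column (?K * zo (matX E (2 * Suc l))) h"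
    using h(1) by (intro resolving_column_mult[OF K zX, where q = 2]) auto
  moreover have "[d] \<in># wd (matQ E (2 * Suc l)) $$ (j, h)"
    using h(2) wQ j h(1) by (subst mem_wd) auto
  ultimately show ?thesis
    by (intro resolving_column_mult_leftD[OF transfer_matrix_carrier wQ j h(1)]) (simp_all only: eq)
qed

section \<open>The step map along paths, its inverse and its bijectivity\<close>

definition first_letter :: "(int \<Rightarrow> 'a) \<Rightarrow> 'a" where
  "first_letter x = the (kappa0 E (x 0)) ! 0"

lemma step_map_letter:
  assumes "kappa0 E (x i) = Some [c, d]" "kappa0 E (x (i + 1)) = Some [c', d']" "kappa1 E a = Some [d, c']"
  shows "step_map E x i = a"
  using assms by (simp add: step_map_eq the_kappa1)

lemma step_map_translate: "step_map E (translate p x) = translate p (step_map E x)"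
  by (simp add: fun_eq_iff step_map_eq translate_def add.assoc)

lemma step_map_agree: "agree_from p x y \<Longrightarrow> agree_from p (step_map E x) (step_map E y)"
  by (simp add: agree_from_def step_map_eq)

lemma first_letter_agree: "agree_from 0 x y \<Longrightarrow> first_letter x = first_letter y"
  by (simp add: agree_from_def first_letter_def)

text \<open>One symbol more is needed than is produced, because the last d still waits for its c.
  Exchanges run from the end of the path to its front, each pushing the \<open>P Y\<close> edge one
  letter to the left.\<close>

lemma labelled_path_forward:
  "labelled_path S l i (segment x (Suc n)) j \<Longrightarrow>
    \<exists>u<msize S' (Suc l). \<exists>j'. edge l i (first_letter x) u \<and>
      labelled_path S' (Suc l) u (segment (step_map E x) n) j'"
proof (induction n arbitrary: l i x)
  case 0
  then obtain v where "i < msize S l" "v < msize S (Suc l)" "x 0 \<in># sym_mat S l $$ (i, v)"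
    by (auto simp: segment_Suc labelled_path.simps)
  with edge_exists show ?case
    by (fastforce simp: first_letter_def labelled_path.simps)
next
  case (Suc n)
  then obtain v where v: "i < msize S l" "v < msize S (Suc l)" "x 0 \<in># sym_mat S l $$ (i, v)"
      and path: "labelled_path S (Suc l) v (segment (shift x) (Suc n)) j"
    by (auto simp: segment_Suc[of x] labelled_path.simps)
  obtain u j' where u: "u < msize S' (Suc (Suc l))" "edge (Suc l) v (first_letter (shift x)) u"
      "labelled_path S' (Suc (Suc l)) u (segment (step_map E (shift x)) n) j'"
    using Suc.IH[OF path] by blast
  obtain t a c d where t: "t < msize S' (Suc l)" "kappa0 E (x 0) = Some [c, d]" "edge l i c t"
      "a \<in># sym_mat S' (Suc l) $$ (t, u)" "kappa1 E a = Some [d, first_letter (shift x)]"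
    using edge_exchange[OF v(1,2) u(1) v(3) u(2)] by blast
  from path obtain v' where v': "v' < msize S (Suc (Suc l))" "shift x 0 \<in># sym_mat S (Suc l) $$ (v, v')"
    by (auto simp: segment_Suc[of "shift x"] labelled_path.simps)
  then obtain c' d' where "kappa0 E (x 1) = Some [c', d']"
    using factor[OF v(2) v'] by (auto simp: shift_def)
  with t have "step_map E x 0 = a"
    by (intro step_map_letter) (auto simp: first_letter_def shift_def)
  moreover have "shift (step_map E x) = step_map E (shift x)"
    by (simp add: shift_eq_translate step_map_translate)
  ultimately have "labelled_path S' (Suc l) t (segment (step_map E x) (Suc n)) j'"
    using t u by (auto simp: segment_Suc labelled_path.simps)
  moreover have "first_letter x = c"
    using t by (simp add: first_letter_def)
  ultimately show ?case using t by blast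
qed

lemma ray_forward:
  assumes "ray S l i x"
  shows "\<exists>u<msize S' (Suc l). edge l i (first_letter x) u \<and> ray S' (Suc l) u (step_map E x)"
proof -
  have "\<exists>u\<in>{..<msize S' (Suc l)}. \<forall>n. edge l i (first_letter x) u \<and>
      (\<exists>j. labelled_path S' (Suc l) u (segment (step_map E x) n) j)"
  proof (rule uniform_witness)
    fix n
    obtain j where "labelled_path S l i (segment x (Suc n)) j"
      using assms unfolding ray_def by blast
    from labelled_path_forward[OF this]
    show "\<exists>u\<in>{..<msize S' (Suc l)}. edge l i (first_letter x) u \<and>
        (\<exists>j. labelled_path S' (Suc l) u (segment (step_map E x) n) j)"
      by blast
  qed (auto simp: segment_snoc labelled_path_append)
  then show ?thesis by (auto simp: ray_def)
qed

text \<open>The sequence \<open>(c\<^sub>i d\<^sub>i)\<close> with \<open>c\<^sub>0 = c\<close> whose image under \<^const>\<open>step_map\<close> is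
  \<open>z = (d\<^sub>i c\<^bsub>i+1\<^esub>)\<close>; only its nonnegative part is meaningful.\<close>

definition pull_back :: "'a \<Rightarrow> (int \<Rightarrow> 'a) \<Rightarrow> int \<Rightarrow> 'a" where
  "pull_back c z = (\<lambda>t. THE a. kappa0 E a =
     Some [if t \<le> 0 then c else the (kappa1 E (z (t - 1))) ! 1, the (kappa1 E (z t)) ! 0])"

lemma shift_pull_back:
  "agree_from 0 (shift (pull_back c z)) (pull_back (the (kappa1 E (z 0)) ! 1) (shift z))"
  by (auto simp: agree_from_def shift_def pull_back_def)

text \<open>One step of undoing the map: the exchange run backwards yields a letter coded by
  \<open>[c, d]\<close>, and injectivity of \<open>kappa0\<close> identifies it with the value
  chosen by \<open>THE\<close>. The letter c' becomes the new c.\<close>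

lemma pull_back_Suc:
  assumes "i < msize S l" "u < msize S' (Suc l)" "edge l i c u" "ray S' (Suc l) u z"
  obtains v u' c' d where "v < msize S (Suc l)" "u' < msize S' (Suc (Suc l))"
    "kappa1 E (z 0) = Some [d, c']" "kappa0 E (pull_back c z 0) = Some [c, d]"
    "pull_back c z 0 \<in># sym_mat S l $$ (i, v)" "edge (Suc l) v c' u'" "ray S' (Suc (Suc l)) u' (shift z)"
proof -
  obtain u' where u': "u' < msize S' (Suc (Suc l))" "z 0 \<in># sym_mat S' (Suc l) $$ (u, u')"
      "ray S' (Suc (Suc l)) u' (shift z)"
    using assms(4) unfolding ray_Suc[of S' "Suc l"] by blast
  obtain v a c' d where v: "v < msize S (Suc l)" "kappa1 E (z 0) = Some [d, c']" "edge (Suc l) v c' u'"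
      "a \<in># sym_mat S l $$ (i, v)" "kappa0 E a = Some [c, d]"
    using edge_exchange_back[OF assms(1,2) u'(1) assms(3) u'(2)] by blast
  have "pull_back c z 0 = a"
    using v by (simp add: pull_back_def the_kappa0)
  with v u' show ?thesis by (intro that[of v u' d c']) simp_all
qed

lemma labelled_path_pull_back:
  "i < msize S l \<Longrightarrow> u < msize S' (Suc l) \<Longrightarrow> edge l i c u \<Longrightarrow> ray S' (Suc l) u z \<Longrightarrow>
    \<exists>j. labelled_path S l i (segment (pull_back c z) n) j"
proof (induction n arbitrary: l i u c z)
  case 0
  then show ?case by (auto simp: labelled_path.simps)
next
  case (Suc n)
  obtain v u' c' d where v: "v < msize S (Suc l)" "u' < msize S' (Suc (Suc l))"
    "kappa1 E (z 0) = Some [d, c']" "kappa0 E (pull_back c z 0) = Some [c, d]"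
    "pull_back c z 0 \<in># sym_mat S l $$ (i, v)" "edge (Suc l) v c' u'" "ray S' (Suc (Suc l)) u' (shift z)"
    using pull_back_Suc[OF Suc.prems] .
  have "segment (shift (pull_back c z)) n = segment (pull_back c' (shift z)) n"
    using segment_agree[OF shift_pull_back[of c z]] v(3) by simp
  then show ?case
    using Suc.IH[OF v(1,2,6,7)] v Suc.prems by (auto simp: segment_Suc labelled_path.simps)
qed

lemma step_map_pull_back_nat:
  "i < msize S l \<Longrightarrow> u < msize S' (Suc l) \<Longrightarrow> edge l i c u \<Longrightarrow> ray S' (Suc l) u z \<Longrightarrow>
    step_map E (pull_back c z) (int n) = z (int n)"
proof (induction n arbitrary: l i u c z)
  case 0
  obtain v u' c' d where v: "v < msize S (Suc l)" "u' < msize S' (Suc (Suc l))"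
    "kappa1 E (z 0) = Some [d, c']" "kappa0 E (pull_back c z 0) = Some [c, d]"
    "edge (Suc l) v c' u'" "ray S' (Suc (Suc l)) u' (shift z)"
    using pull_back_Suc[OF 0] by metis
  \<comment> \<open>The step map at 0 also looks at position 1, whose code must begin with the same
    c'; that position is the head of the next pull back.\<close>
  obtain d' where d': "kappa0 E (pull_back c' (shift z) 0) = Some [c', d']"
    using pull_back_Suc[OF v(1,2,5,6)] by metis
  have "pull_back c z 1 = pull_back c' (shift z) 0"
    using v(3) by (simp add: pull_back_def shift_def)
  with v d' show ?case by (simp add: step_map_letter)
next
  case (Suc n)
  obtain v u' c' d where v: "v < msize S (Suc l)" "u' < msize S' (Suc (Suc l))"
    "kappa1 E (z 0) = Some [d, c']" "edge (Suc l) v c' u'" "ray S' (Suc (Suc l)) u' (shift z)"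
    using pull_back_Suc[OF Suc.prems] by metis
  have "step_map E (pull_back c z) (int (Suc n)) = step_map E (shift (pull_back c z)) (int n)"
    by (simp add: shift_eq_translate step_map_translate) (simp add: translate_def)
  also have "\<dots> = step_map E (pull_back c' (shift z)) (int n)"
    using step_map_agree[OF shift_pull_back[of c z]] v(3) by (simp add: agree_from_def)
  also have "\<dots> = z (int (Suc n))"
    using Suc.IH[OF v(1,2,4,5)] by (simp add: shift_def add.commute)
  finally show ?case .
qed

lemma ray_backward:
  assumes "i < msize S l" "u < msize S' (Suc l)" "edge l i c u" "ray S' (Suc l) u z"
  shows "ray S l i (pull_back c z)" "first_letter (pull_back c z) = c"
    "agree_from 0 (step_map E (pull_back c z)) z"
proof -
  show "ray S l i (pull_back c z)"
    using labelled_path_pull_back[OF assms] by (simp add: ray_def)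
  obtain d where "kappa0 E (pull_back c z 0) = Some [c, d]"
    using pull_back_Suc[OF assms] by metis
  then show "first_letter (pull_back c z) = c"
    by (simp add: first_letter_def)
  show "agree_from 0 (step_map E (pull_back c z)) z"
    unfolding agree_from_def using step_map_pull_back_nat[OF assms] by (metis nonneg_int_cases)
qed

text \<open>Two consecutive edges of a path through position i suffice: they supply d and c', and
  the exchange supplies the symbol of M' with code \<open>[d, c']\<close>.\<close>

lemma step_letters:
  assumes "x \<in> presented_subshift S"
  obtains c d c' d' where "kappa0 E (x i) = Some [c, d]" "kappa0 E (x (i + 1)) = Some [c', d']"
    "kappa1 E (step_map E x i) = Some [d, c']"
proof -
  obtain h where "ray S 0 h (translate i x)"
    using assms subshift_iff_ray[OF source] by blast
  then obtain v where v: "h < msize S 0" "v < msize S (Suc 0)" "x i \<in># sym_mat S 0 $$ (h, v)"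
      and ray: "ray S (Suc 0) v (shift (translate i x))"
    unfolding ray_Suc[of S 0] by (auto simp: translate_def)
  from ray obtain w where w: "w < msize S (Suc (Suc 0))" "x (i + 1) \<in># sym_mat S (Suc 0) $$ (v, w)"
    unfolding ray_Suc[of S "Suc 0"] by (auto simp: translate_def shift_def)
  obtain c' d' u where c': "kappa0 E (x (i + 1)) = Some [c', d']" "u < msize S' (Suc (Suc 0))" "edge (Suc 0) v c' u"
    using edge_exists[OF v(2) w] by blast
  obtain c d a where c: "kappa0 E (x i) = Some [c, d]" "kappa1 E a = Some [d, c']"
    using edge_exchange[OF v(1,2) c'(2) v(3) c'(3)] by blast
  with c' have "step_map E x i = a" by (intro step_map_letter)
  with c c' show ?thesis by (intro that) auto
qed

lemma step_map_in:
  assumes "x \<in> presented_subshift S"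
  shows "step_map E x \<in> presented_subshift S'"
proof (rule subshiftI_ray)
  fix p
  obtain i where "ray S 0 i (translate p x)"
    using assms subshift_iff_ray[OF source] by blast
  from ray_forward[OF this] show "\<exists>l i. ray S' l i (translate p (step_map E x))"
    unfolding step_map_translate by blast
qed

text \<open>Regrouping twice is a shift: (c d)(c' d') becomes d c' and then c' d'.\<close>

lemma dual_step_map:
  assumes "x \<in> presented_subshift S"
  shows "step_map (dual_data E) (step_map E x) = shift x"
proof
  fix i
  obtain c d c' d' where 1: "kappa0 E (x (i + 1)) = Some [c', d']" "kappa1 E (step_map E x i) = Some [d, c']"
    using step_letters[OF assms, of i] by metis
  obtain d1 c2 where 2: "kappa0 E (x (i + 1)) = Some [c', d1]" "kappa1 E (step_map E x (i + 1)) = Some [d1, c2]"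
    using step_letters[OF assms, of "i + 1"] 1 by (metis option.inject list.inject)
  from 1 2 show "step_map (dual_data E) (step_map E x) i = shift x i"
    by (simp add: step_map_eq the_kappa0 shift_def)
qed

end

context one_step
begin

interpretation D: one_step "dual_data E" S' S
  by (rule dual)

text \<open>The dual step map is a left inverse up to the shift, and by duality also a right inverse
  up to the shift; the shift itself is bijective on both subshifts.\<close>

lemma bij_betw_step_map: "bij_betw (step_map E) (presented_subshift S) (presented_subshift S')"
proof (rule bij_betw_imageI)
  show "inj_on (step_map E) (presented_subshift S)"
    by (metis (no_types, lifting) bij_betw_imp_inj_on bij_betw_shift dual_step_map inj_onI inj_onD)
  show "step_map E ` presented_subshift S = presented_subshift S'"
  proof (intro equalityI subsetI)
    fix z assume z: "z \<in> presented_subshift S'"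
    define y where "y = translate (- 1) z"
    have "y \<in> presented_subshift S'" "shift y = z"
      using z by (simp_all add: y_def translate_presented shift_eq_translate translate_translate)
    then have "step_map E (step_map (dual_data E) y) = z" "step_map (dual_data E) y \<in> presented_subshift S"
      using D.dual_step_map D.step_map_in by auto
    then show "z \<in> step_map E ` presented_subshift S" by blast
  qed (auto simp: step_map_in)
qed

text \<open>The image at t contains d at t and c at t+1. Thus c at t is stored in the image at t-1,
  and only c at 0 has to come from the first letter; nothing beyond m symbols is gained.\<close>

lemma recover_segment:
  assumes x: "x \<in> presented_subshift S" and y: "y \<in> presented_subshift S"
    and first: "first_letter x = first_letter y"
    and seg: "segment (step_map E x) m = segment (step_map E y) m"
  shows "segment x m = segment y m"
proof -
  have eq: "step_map E x (int t) = step_map E y (int t)" if "t < m" for t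
    using seg that by (simp add: segment_def)
  have "x (int t) = y (int t)" if "t < m" for t
  proof -
    obtain c d c' d' where 1: "kappa0 E (x (int t)) = Some [c, d]" "kappa1 E (step_map E x (int t)) = Some [d, c']"
      using step_letters[OF x] by metis
    obtain b e b' e' where 2: "kappa0 E (y (int t)) = Some [b, e]" "kappa1 E (step_map E y (int t)) = Some [e, b']"
      using step_letters[OF y] by metis
    have "d = e" using 1 2 eq[OF that] by simp
    moreover have "c = b"
    proof (cases t)
      case 0
      with first 1 2 show ?thesis by (simp add: first_letter_def)
    next
      case (Suc s)
      have s: "int s + 1 = int t" using Suc by simp
      obtain c0 d0 d1 where "kappa0 E (x (int t)) = Some [c0, d1]"
          "kappa1 E (step_map E x (int s)) = Some [d0, c0]"
        using step_letters[OF x, of "int s"] unfolding s by metis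
      moreover obtain b0 e0 e1 where "kappa0 E (y (int t)) = Some [b0, e1]"
          "kappa1 E (step_map E y (int s)) = Some [e0, b0]"
        using step_letters[OF y, of "int s"] unfolding s by metis
      ultimately show ?thesis
        using 1 2 eq[of s] Suc that by simp
    qed
    ultimately show ?thesis using 1 2 kappa0_inj by metis
  qed
  then show ?thesis by (simp add: segment_def)
qed

lemma transfer_step: "transfer S S' 1 0 transfer_matrix (step_map E) (\<lambda>x. [first_letter x])"
proof (rule transfer.intro, goal_cases)
  case 1 show ?case by (rule source)
next
  case 2 show ?case by (rule target)
next
  case (3 l) show ?case using transfer_matrix_carrier by simp
next
  case (4 w l)
  then show ?case
    unfolding symbols_of_carrier[OF transfer_matrix_carrier] by (auto simp: mem_transfer_matrix)
next
  case 5
  have "(\<Union>l. symbols_of (transfer_matrix l)) \<subseteq> (\<lambda>c. [c]) ` alphC E"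
  proof (rule UN_least, rule subsetI)
    fix l w
    assume "w \<in> symbols_of (transfer_matrix l)"
    then obtain i j c where "i < msize S l" "w = [c]" "edge l i c j"
      unfolding symbols_of_carrier[OF transfer_matrix_carrier] by (auto simp: mem_transfer_matrix)
    then have "w = [c]" "c \<in> symbols_of (matP E (2 * l))"
      unfolding symbols_of_carrier[OF P_even_carrier] edge_def by auto
    then show "w \<in> (\<lambda>c. [c]) ` alphC E"
      using P_over by blast
  qed
  then show ?case by (rule finite_subset) (simp add: finite_C)
next
  case (6 l) show ?case using transfer_matrix_inc by simp
next
  case (7 j l) then show ?case using transfer_matrix_resolving by simp
next
  case (8 i l)
  obtain v a where "v < msize S (Suc l)" "a \<in># sym_mat S l $$ (i, v)"
    using emits[OF source 8] by blast
  then obtain u c where "u < msize S' (Suc l)" "edge l i c u"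
    using edge_exists[OF 8] by blast
  then show ?case using mem_transfer_matrix[OF 8, of u "[c]"] by auto
next
  case (9 j l)
  then have j: "j < msize S' (Suc (Suc l))" by simp
  obtain i c where "i < msize S (Suc l)" "edge (Suc l) i c j"
    using transfer_matrix_column[OF j] by blast
  then show ?case using mem_transfer_matrix[of i "Suc l" j "[c]"] j by auto
next
  case (10 h l v u a w)
  then have u: "u < msize S' (Suc (Suc l))" by simp
  obtain c' where "edge (Suc l) v c' u"
    using mem_transfer_matrix[OF 10(2) u] 10(5) by blast
  then obtain v' a' c where "v' < msize S' (Suc l)" "edge l h c v'" "a' \<in># sym_mat S' (Suc l) $$ (v', u)"
    using edge_exchange[OF 10(1,2) u 10(4)] by blast
  then show ?case using mem_transfer_matrix[OF 10(1), of v' "[c]"] by auto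
next
  case (11 l i x)
  obtain u where "u < msize S' (Suc l)" "edge l i (first_letter x) u" "ray S' (Suc l) u (step_map E x)"
    using ray_forward[OF 11] by blast
  then show ?case using mem_transfer_matrix[OF ray_bound[OF 11], of u "[first_letter x]"] by auto
next
  case (12 i l u w z)
  then have u: "u < msize S' (Suc l)" "ray S' (Suc l) u z" by simp_all
  obtain c where "w = [c]" "edge l i c u"
    using mem_transfer_matrix[OF 12(1) u(1)] 12(3) by blast
  then show ?case using ray_backward[OF 12(1) u(1) _ u(2), of c] by blast
next
  case (13 x y) then show ?case using first_letter_agree by blast
next
  case (14 p x y) then show ?case using step_map_agree by simp
next
  case (15 x y m)
  then show ?case using recover_segment[OF 15(1,2) _ 15(4)] by simp
next
  case 16 show ?case by (rule bij_betw_step_map)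
next
  case 17
  show ?case
  proof (rule continuous_map_shift_topologyI)
    show "continuous_map (shift_topology (presented_subshift S)) (discrete_topology UNIV) (\<lambda>x. step_map E x i)" for i
      unfolding step_map_eq
      by (rule continuous_map_discrete2[OF continuous_map_coordinate continuous_map_coordinate,
            where G = "\<lambda>a b. THE a'. kappa1 E a' = Some [the (kappa0 E a) ! 1, the (kappa0 E b) ! 0]"])
  qed (rule step_map_in)
next
  case 18
  show ?case
    unfolding first_letter_def
    by (rule continuous_map_discrete2[OF continuous_map_coordinate[where i = 0]
          continuous_map_coordinate[where i = 0], where G = "\<lambda>a b. [the (kappa0 E a) ! 0]"])
qed

end

section \<open>The conjugacy defined by a transfer\<close>

lemma symbolic_matrix_systemI:
  assumes "finite (alphabet S)"
    and "\<And>l. sym_mat S l \<in> carrier_mat (msize S l) (msize S (Suc l))"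
    and "\<And>l. symbols_of (sym_mat S l) \<subseteq> alphabet S"
    and "\<And>l. inc_mat S l \<in> carrier_mat (msize S l) (msize S (Suc l))"
    and "\<And>l. zero_one_matrix (inc_mat S l)"
    and "\<And>l. zo (inc_mat S l) * wd (sym_mat S (Suc l)) = wd (sym_mat S l) * zo (inc_mat S (Suc l))"
    and "\<And>l i. i < msize S l \<Longrightarrow> \<exists>j<msize S (Suc l). inc_mat S l $$ (i, j) \<noteq> 0"
    and "\<And>l j. j < msize S (Suc l) \<Longrightarrow> \<exists>!i. i < msize S l \<and> inc_mat S l $$ (i, j) \<noteq> 0"
    and "\<And>l i. i < msize S l \<Longrightarrow> \<exists>j<msize S (Suc l). \<exists>a. a \<in># sym_mat S l $$ (i, j)"
    and "\<And>l j. j < msize S (Suc l) \<Longrightarrow> \<exists>i<msize S l. \<exists>a. a \<in># sym_mat S l $$ (i, j)"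
    and "\<And>l j. j < msize S (Suc l) \<Longrightarrow> resolving_column (sym_mat S l) j"
  shows "symbolic_matrix_system S"
  unfolding symbolic_matrix_system_iff
  by (intro conjI allI impI; rule assms; assumption)

text \<open>These are the incidence matrices of surjections from b points onto a points, the shape
  of \<iota>; they are closed under products as surjections compose.\<close>

definition function_like :: "nat mat \<Rightarrow> nat \<Rightarrow> nat \<Rightarrow> bool" where
  "function_like A a b \<longleftrightarrow> A \<in> carrier_mat a b \<and> zero_one_matrix A \<and>
    (\<forall>i<a. \<exists>j<b. A $$ (i, j) \<noteq> 0) \<and> (\<forall>j<b. \<exists>!i. i < a \<and> A $$ (i, j) \<noteq> 0)"

lemma function_like_one: "function_like (1\<^sub>m a) a a"
  unfolding function_like_def by (auto simp: zero_one_matrix_carrier[of _ a a] split: if_splits)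

lemma function_like_mult:
  assumes A: "function_like A a b" and B: "function_like B b c"
  shows "function_like (A * B) a c"
proof -
  have cA: "A \<in> carrier_mat a b" and cB: "B \<in> carrier_mat b c"
    using A B by (auto simp: function_like_def)
  note cAB = mult_carrier_mat[OF cA cB]
  note nz = nat_mult_mat_nonzero[OF cA cB]
  have "(A * B) $$ (i, j) \<le> 1" if ij: "i < a" "j < c" for i j
  proof -
    obtain h where h: "h < b" "B $$ (h, j) \<noteq> 0" "\<And>h'. h' < b \<Longrightarrow> h' \<noteq> h \<Longrightarrow> B $$ (h', j) = 0"
      using B ij(2) unfolding function_like_def by metis
    have "(A * B) $$ (i, j) = (\<Sum>h'<b. if h' = h then A $$ (i, h) * B $$ (h, j) else 0)"
      unfolding index_mult_sum[OF cA cB ij] by (rule sum.cong) (use h(3) in auto)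
    also have "\<dots> = A $$ (i, h) * B $$ (h, j)"
      using h(1) by simp
    also have "\<dots> \<le> 1 * 1"
      using A B ij h(1)
      by (intro mult_mono) (auto simp: function_like_def zero_one_matrix_carrier[OF cA] zero_one_matrix_carrier[OF cB])
    finally show ?thesis by simp
  qed
  then have "zero_one_matrix (A * B)"
    by (simp add: zero_one_matrix_carrier[OF cAB])
  moreover have "\<exists>j<c. (A * B) $$ (i, j) \<noteq> 0" if i: "i < a" for i
  proof -
    obtain h where "h < b" "A $$ (i, h) \<noteq> 0" using A i unfolding function_like_def by blast
    moreover then obtain j where "j < c" "B $$ (h, j) \<noteq> 0" using B unfolding function_like_def by blast
    ultimately show ?thesis using nz[OF i] by blast
  qed
  moreover have "\<exists>!i. i < a \<and> (A * B) $$ (i, j) \<noteq> 0" if j: "j < c" for j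
  proof -
    obtain h where h: "h < b" "B $$ (h, j) \<noteq> 0" "\<And>h'. h' < b \<Longrightarrow> B $$ (h', j) \<noteq> 0 \<Longrightarrow> h' = h"
      using B j unfolding function_like_def by metis
    obtain i where i: "i < a" "A $$ (i, h) \<noteq> 0" "\<And>i'. i' < a \<Longrightarrow> A $$ (i', h) \<noteq> 0 \<Longrightarrow> i' = i"
      using A h(1) unfolding function_like_def by metis
    show ?thesis
    proof (rule ex1I[of _ i])
      show "i < a \<and> (A * B) $$ (i, j) \<noteq> 0" using i h nz[OF i(1) j] by blast
    next
      fix i' assume "i' < a \<and> (A * B) $$ (i', j) \<noteq> 0"
      then show "i' = i" using nz[of i' j] j h(3) i(3) by metis
    qed
  qed
  ultimately show ?thesis
    unfolding function_like_def using cAB by blast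
qed

lemma mat_prod_Nil [simp]: "mat_prod d [] = 1\<^sub>m d"
  by (simp add: mat_prod_def)

lemma mat_prod_snoc [simp]: "mat_prod d (As @ [A]) = mat_prod d As * A"
  by (simp add: mat_prod_def)

lemma function_like_inc_prod:
  assumes "symbolic_matrix_system S"
  shows "function_like (mat_prod (msize S l) (map (inc_mat S) [l..<l + n])) (msize S l) (msize S (l + n))"
proof (induction n)
  case 0
  then show ?case by (simp add: function_like_one)
next
  case (Suc n)
  have "function_like (inc_mat S (l + n)) (msize S (l + n)) (msize S (l + Suc n))"
    unfolding function_like_def
    using inc_carrier[OF assms] inc_zero_one[OF assms] inc_row[OF assms] inc_column[OF assms] by simp
  from function_like_mult[OF Suc this] show ?case by simp
qed

context transfer
begin

lemma inc_prod_commute: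
  "zo (mat_prod (msize S l) (map (inc_mat S) [l..<l + n])) * F (l + n) =
    F l * zo (mat_prod (msize S' (l + q)) (map (inc_mat S') [l + q..<l + q + n]))"
proof (induction n)
  case 0
  have "F l \<in> carrier_mat (msize S l) (msize S' (l + q))" by (rule carrier)
  then show ?case by (simp add: zo_one)
next
  case (Suc n)
  let ?A = "mat_prod (msize S l) (map (inc_mat S) [l..<l + n])"
  let ?B = "mat_prod (msize S' (l + q)) (map (inc_mat S') [l + q..<l + q + n])"
  have A: "?A \<in> carrier_mat (msize S l) (msize S (l + n))"
    and B: "?B \<in> carrier_mat (msize S' (l + q)) (msize S' (l + q + n))"
    using function_like_inc_prod source target by (auto simp: function_like_def)
  have I: "inc_mat S (l + n) \<in> carrier_mat (msize S (l + n)) (msize S (Suc (l + n)))"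
    and I': "inc_mat S' (l + q + n) \<in> carrier_mat (msize S' (l + q + n)) (msize S' (Suc (l + q + n)))"
    using inc_carrier source target by auto
  have F: "F (l + n) \<in> carrier_mat (msize S (l + n)) (msize S' (l + q + n))"
    "F (Suc (l + n)) \<in> carrier_mat (msize S (Suc (l + n))) (msize S' (Suc (l + q + n)))"
    using carrier[of "l + n"] carrier[of "Suc (l + n)"] by (simp_all add: ac_simps)
  have comm: "zo (inc_mat S (l + n)) * F (Suc (l + n)) = F (l + n) * zo (inc_mat S' (l + q + n))"
    using inc_commute[of "l + n"] by (simp add: ac_simps)
  have c: "zo ?A \<in> carrier_mat (msize S l) (msize S (l + n))"
    "zo (inc_mat S (l + n)) \<in> carrier_mat (msize S (l + n)) (msize S (Suc (l + n)))"
    "zo ?B \<in> carrier_mat (msize S' (l + q)) (msize S' (l + q + n))"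
    "zo (inc_mat S' (l + q + n)) \<in> carrier_mat (msize S' (l + q + n)) (msize S' (Suc (l + q + n)))"
    using A B I I' by simp_all
  have "zo (?A * inc_mat S (l + n)) * F (Suc (l + n)) = zo ?A * F (l + n) * zo (inc_mat S' (l + q + n))"
    by (simp only: zo_mult[OF A I] assoc_mult_mat[OF c(1,2) F(2)] comm assoc_mult_mat[OF c(1) F(1) c(4)])
  also have "\<dots> = F l * zo (?B * inc_mat S' (l + q + n))"
    by (simp only: Suc zo_mult[OF B I'] assoc_mult_mat[OF carrier c(3,4)])
  finally show ?case by simp
qed

end

lemma image_mset_of_nat_mult:
  fixes U :: "'a::monoid_add multiset" and s :: "'a \<Rightarrow> 'b::monoid_add"
  shows "image_mset s (of_nat n * U) = of_nat n * image_mset s U"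
    and "image_mset s (U * of_nat n) = image_mset s U * of_nat n"
  by (induction n) (simp_all add: distrib_left distrib_right)

text \<open>Making words into single symbols is not multiplicative for symbolic factors, but a 0-1
  factor contributes only the empty word and so changes multiplicities alone.\<close>

lemma zo_mult_wd:
  fixes B :: "'a word_matrix"
  assumes "A \<in> carrier_mat a b" "B \<in> carrier_mat b c"
  shows "zo A * wd B = wd (zo A * B)"
proof (rule eq_matI)
  fix i j
  assume "i < dim_row (wd (zo A * B))" "j < dim_col (wd (zo A * B))"
  then have ij: "i < a" "j < c" using assms by (simp_all add: wd_def zo_def)
  have zA: "zo A \<in> carrier_mat a b" using assms(1) by simp
  have "(zo A * wd B) $$ (i, j) = (\<Sum>h<b. zo A $$ (i, h) * wd B $$ (h, j))"
    using assms ij by (intro index_mult_sum) auto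
  also have "\<dots> = (\<Sum>h<b. image_mset (\<lambda>u. [u]) (zo A $$ (i, h) * B $$ (h, j)))"
    using assms ij by (intro sum.cong) (auto simp: zo_def wd_def image_mset_of_nat_mult)
  also have "\<dots> = wd (zo A * B) $$ (i, j)"
    using index_mult_sum[OF zA assms(2) ij] ij assms by (simp add: wd_def image_mset_sum' zo_def del: index_mult_mat(1))
  finally show "(zo A * wd B) $$ (i, j) = wd (zo A * B) $$ (i, j)" .
qed (simp_all add: wd_def zo_def)

lemma wd_mult_zo:
  fixes A :: "'a word_matrix"
  assumes "A \<in> carrier_mat a b" "B \<in> carrier_mat b c"
  shows "wd A * zo B = wd (A * zo B)"
proof (rule eq_matI)
  fix i j
  assume "i < dim_row (wd (A * zo B))" "j < dim_col (wd (A * zo B))"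
  then have ij: "i < a" "j < c" using assms by (simp_all add: wd_def zo_def)
  have zB: "zo B \<in> carrier_mat b c" using assms(2) by simp
  have "(wd A * zo B) $$ (i, j) = (\<Sum>h<b. wd A $$ (i, h) * zo B $$ (h, j))"
    using assms ij by (intro index_mult_sum) auto
  also have "\<dots> = (\<Sum>h<b. image_mset (\<lambda>u. [u]) (A $$ (i, h) * zo B $$ (h, j)))"
    using assms ij by (intro sum.cong) (auto simp: zo_def wd_def image_mset_of_nat_mult)
  also have "\<dots> = wd (A * zo B) $$ (i, j)"
    using index_mult_sum[OF assms(1) zB ij] ij assms by (simp add: wd_def image_mset_sum' zo_def del: index_mult_mat(1))
  finally show "(wd A * zo B) $$ (i, j) = wd (A * zo B) $$ (i, j)" .
qed (simp_all add: wd_def zo_def)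

text \<open>Each edge of \<open>F\<close> climbs q levels, so level l of the new system sits at
  level \<open>l * q\<close> of the old one.\<close>

definition induced_system :: "'a matrix_system \<Rightarrow> nat \<Rightarrow> (nat \<Rightarrow> 'a word_matrix) \<Rightarrow> 'a list matrix_system" where
  "induced_system S q F =
    \<lparr>alphabet = (\<Union>l. symbols_of (F (l * q))), sym_mat = (\<lambda>l. F (l * q)), inc_mat = I_power S q\<rparr>"

text \<open>\<open>expanding\<close> will make itineraries injective. \<open>receiving\<close>
  strengthens \<open>column\<close> to all starting levels, including 0, as the standing assumptions
  on the induced system demand.\<close>

locale self_transfer = transfer S S q e F f g
  for S :: "'a matrix_system" and q e :: nat
    and F :: "nat \<Rightarrow> 'a word_matrix"
    and f :: "(int \<Rightarrow> 'a) \<Rightarrow> int \<Rightarrow> 'a"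
    and g :: "(int \<Rightarrow> 'a) \<Rightarrow> 'a list" +
  assumes expanding: "e \<ge> 1"
    and receiving: "j < msize S (l + q) \<Longrightarrow> \<exists>i<msize S l. \<exists>w. w \<in># F l $$ (i, j)"
begin

abbreviation "T \<equiv> induced_system S q F"
abbreviation "\<Lambda> \<equiv> presented_subshift S"

lemma msize_induced: "msize T l = msize S (l * q)"
  using carrier_matD(1)[OF carrier[of "l * q"]] unfolding msize_def[of T]
  by (simp add: induced_system_def)

lemma sym_induced: "sym_mat T l = F (l * q)"
  by (simp add: induced_system_def)

lemma inc_induced: "inc_mat T l = mat_prod (msize S (l * q)) (map (inc_mat S) [l * q..<l * q + q])"
  by (simp add: induced_system_def I_power_def add.commute)

lemma symbolic_matrix_system_induced: "symbolic_matrix_system T"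
proof (rule symbolic_matrix_systemI)
  note inc = function_like_inc_prod[OF source, of "l * q" q for l, folded inc_induced]
  have Suc: "msize T (Suc l) = msize S (l * q + q)" for l
    by (simp add: msize_induced add.commute)
  note sym = sym_induced
  have sym_Suc: "sym_mat T (Suc l) = F (l * q + q)" for l
    by (simp add: induced_system_def add.commute)
  have al: "alphabet T = (\<Union>l. symbols_of (F (l * q)))"
    by (simp add: induced_system_def)
  show "finite (alphabet T)"
    unfolding al by (rule finite_subset[OF _ finite_words]) auto
  show C: "sym_mat T l \<in> carrier_mat (msize T l) (msize T (Suc l))" for l
    unfolding sym Suc msize_induced[of l] by (rule carrier)
  show "symbols_of (sym_mat T l) \<subseteq> alphabet T" for l
    unfolding sym al by blast
  show I: "inc_mat T l \<in> carrier_mat (msize T l) (msize T (Suc l))" for l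
    unfolding Suc msize_induced[of l] using inc by (simp add: function_like_def)
  show "zero_one_matrix (inc_mat T l)" for l
    using inc by (simp add: function_like_def)
  have "zo (inc_mat T l) * sym_mat T (Suc l) = sym_mat T l * zo (inc_mat T (Suc l))" for l
    using inc_prod_commute[of "l * q" q]
    unfolding sym sym_Suc inc_induced by (simp add: add.commute)
  then show "zo (inc_mat T l) * wd (sym_mat T (Suc l)) = wd (sym_mat T l) * zo (inc_mat T (Suc l))" for l
    by (simp only: zo_mult_wd[OF I C] wd_mult_zo[OF C I])
  show "\<exists>j<msize T (Suc l). inc_mat T l $$ (i, j) \<noteq> 0" if "i < msize T l" for l i
    using that inc[of l] unfolding Suc msize_induced[of l] function_like_def by blast
  show "\<exists>!i. i < msize T l \<and> inc_mat T l $$ (i, j) \<noteq> 0" if "j < msize T (Suc l)" for l j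
    using that inc[of l] unfolding Suc msize_induced[of l] function_like_def by blast
  show "\<exists>j<msize T (Suc l). \<exists>a. a \<in># sym_mat T l $$ (i, j)" if "i < msize T l" for l i
    using that row unfolding Suc msize_induced[of l] sym by blast
  show "\<exists>i<msize T l. \<exists>a. a \<in># sym_mat T l $$ (i, j)" if "j < msize T (Suc l)" for l j
    using that receiving unfolding Suc msize_induced[of l] sym by blast
  show "resolving_column (sym_mat T l) j" if "j < msize T (Suc l)" for l j
    using that resolving unfolding Suc sym by blast
qed

lemma labelled_path_orbit:
  "ray S (l * q) i x \<Longrightarrow> \<exists>j. labelled_path T l i (map (\<lambda>t. g ((f ^^ t) x)) [0..<n]) j"
proof (induction n arbitrary: l i x)
  case 0
  then show ?case using ray_bound by (auto simp: labelled_path.simps msize_induced)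
next
  case (Suc n)
  obtain u where u: "u < msize S (l * q + q)" "g x \<in># F (l * q) $$ (i, u)" "ray S (l * q + q) u (f x)"
    using forward[OF Suc.prems] by blast
  then have "ray S (Suc l * q) u (f x)" by (simp add: add.commute)
  from Suc.IH[OF this] obtain j where "labelled_path T (Suc l) u (map (\<lambda>t. g ((f ^^ t) (f x))) [0..<n]) j"
    by blast
  then show ?case
    unfolding map_upt_Suc using u ray_bound[OF Suc.prems]
    by (auto simp: labelled_path.simps msize_induced sym_induced funpow_swap1 add.commute simp del: upt_Suc)
qed

lemma funpow_agree: "agree_from 0 x y \<Longrightarrow> agree_from 0 ((f ^^ n) x) ((f ^^ n) y)"
proof (induction n)
  case (Suc n)
  with map_agree[of 0 "(f ^^ n) x" "(f ^^ n) y"] show ?case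
    by (simp add: agree_from_def)
qed simp

text \<open>The word is undone from its last symbol, starting from an arbitrary ray z at the end of
  the path. Each step fixes images only from 0 on, which is enough since labels see only the
  nonnegative half.\<close>

lemma orbit_of_labelled_path:
  "labelled_path T l i w j \<Longrightarrow> ray S ((l + length w) * q) j z \<Longrightarrow>
    \<exists>x. ray S (l * q) i x \<and> map (\<lambda>t. g ((f ^^ t) x)) [0..<length w] = w"
proof (induction w arbitrary: l i)
  case Nil
  then show ?case by (auto simp: labelled_path.simps)
next
  case (Cons a w)
  then obtain v where v: "i < msize S (l * q)" "v < msize S (l * q + q)" "a \<in># F (l * q) $$ (i, v)"
      and path: "labelled_path T (Suc l) v w j"
    by (auto simp: labelled_path.simps msize_induced sym_induced add.commute)
  obtain x' where x': "ray S (Suc l * q) v x'" "map (\<lambda>t. g ((f ^^ t) x')) [0..<length w] = w"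
    using Cons.IH[OF path] Cons.prems(2) by auto
  then have "ray S (l * q + q) v x'" by (simp add: add.commute)
  from backward[OF v this] obtain x where x: "ray S (l * q) i x" "g x = a" "agree_from 0 (f x) x'"
    by blast
  have "g ((f ^^ t) (f x)) = g ((f ^^ t) x')" for t
    using label_agree[OF funpow_agree[OF x(3)]] .
  then have "map (\<lambda>t. g ((f ^^ t) x)) [0..<length (a # w)] = a # w"
    using x(2) x'(2) by (simp add: map_upt_Suc funpow_swap1 del: upt_Suc)
  with x(1) show ?case by (intro exI conjI)
qed

section \<open>Two-sided iterates and the itinerary map\<close>

definition f_inv :: "(int \<Rightarrow> 'a) \<Rightarrow> int \<Rightarrow> 'a" where
  "f_inv = inv_into \<Lambda> f"

text \<open>Bijectivity of \<open>f\<close> is known only on \<Lambda>, so negative times use its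
  inverse there and the laws below are restricted to points of \<Lambda>.\<close>

definition iterate :: "int \<Rightarrow> (int \<Rightarrow> 'a) \<Rightarrow> int \<Rightarrow> 'a" where
  "iterate t = (if t \<ge> 0 then f ^^ nat t else f_inv ^^ nat (- t))"

definition itinerary :: "(int \<Rightarrow> 'a) \<Rightarrow> int \<Rightarrow> 'a list" where
  "itinerary x = (\<lambda>t. g (iterate t x))"

lemma f_in: "x \<in> \<Lambda> \<Longrightarrow> f x \<in> \<Lambda>"
  using bij by (rule bij_betw_apply)

lemma f_inj: "x \<in> \<Lambda> \<Longrightarrow> y \<in> \<Lambda> \<Longrightarrow> f x = f y \<Longrightarrow> x = y"
  using bij by (auto simp: bij_betw_def inj_on_def)

lemma f_inv: "x \<in> \<Lambda> \<Longrightarrow> f_inv x \<in> \<Lambda>" "x \<in> \<Lambda> \<Longrightarrow> f (f_inv x) = x"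
  using bij by (auto simp: f_inv_def bij_betw_def inv_into_into f_inv_into_f)

text \<open>A continuous bijection from a compact space onto a Hausdorff space is a homeomorphism;
  no formula for the inverse is required.\<close>

lemma continuous_f_inv:
  "continuous_map (shift_topology \<Lambda>) (shift_topology \<Lambda>) f_inv"
proof -
  have "homeomorphic_map (shift_topology \<Lambda>) (shift_topology \<Lambda>) f"
    using bij
    by (intro continuous_imp_homeomorphic_map continuous compact_presented_subshift source
        Hausdorff_shift_topology) (auto simp: bij_betw_def)
  then obtain k where k: "homeomorphic_maps (shift_topology \<Lambda>) (shift_topology \<Lambda>) f k"
    using homeomorphic_map_maps by blast
  have "k x = f_inv x" if "x \<in> \<Lambda>" for x
    using k that f_inv f_in by (auto simp: homeomorphic_maps_def continuous_map_def Pi_iff intro: f_inj)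
  then show ?thesis
    using k continuous_map_eq[of "shift_topology \<Lambda>" "shift_topology \<Lambda>" k f_inv]
    by (simp add: homeomorphic_maps_def)
qed

lemma iterate_in: "x \<in> \<Lambda> \<Longrightarrow> iterate t x \<in> \<Lambda>"
proof -
  assume x: "x \<in> \<Lambda>"
  have "(f ^^ n) x \<in> \<Lambda>" "(f_inv ^^ n) x \<in> \<Lambda>" for n
    by (induction n) (simp_all add: x f_in f_inv)
  then show ?thesis by (simp add: iterate_def)
qed

lemma iterate_0 [simp]: "iterate 0 x = x"
  by (simp add: iterate_def)

lemma iterate_nat: "iterate (int n) x = (f ^^ n) x"
  by (simp add: iterate_def)

lemma iterate_Suc:
  assumes "x \<in> \<Lambda>"
  shows "iterate (t + 1) x = f (iterate t x)"
proof (cases "t \<ge> 0")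
  case True
  then show ?thesis by (simp add: iterate_def nat_add_distrib)
next
  case False
  define n where "n = nat (- (t + 1))"
  have t: "t = - int (Suc n)" using False by (simp add: n_def)
  have "iterate (t + 1) x = (f_inv ^^ n) x"
    using t by (simp add: iterate_def)
  moreover have "iterate t x = f_inv ((f_inv ^^ n) x)"
    using t by (simp add: iterate_def nat_add_distrib)
  moreover have "(f_inv ^^ n) x \<in> \<Lambda>"
    using iterate_in[OF assms, of "t + 1"] \<open>iterate (t + 1) x = _\<close> by simp
  ultimately show ?thesis using f_inv by simp
qed

lemma iterate_add:
  assumes "x \<in> \<Lambda>"
  shows "iterate s (iterate t x) = iterate (s + t) x"
proof (induction s rule: int_induct[where k = 0])
  case (step1 s)
  then show ?case
    using iterate_Suc[OF iterate_in[OF assms], of s t] iterate_Suc[OF assms, of "s + t"]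
    by (simp add: add.commute add.left_commute)
next
  case (step2 s)
  \<comment> \<open>Downward, both sides are compared after one application of \<open>f\<close>,
    which is injective on \<Lambda>.\<close>
  have *: "f (iterate (s - 1) (iterate t x)) = f (iterate (s - 1 + t) x)"
    using iterate_Suc[OF iterate_in[OF assms], of "s - 1" t] iterate_Suc[OF assms, of "s - 1 + t"] step2(2)
    by simp
  show ?case
    by (rule f_inj[OF _ _ *]) (simp_all add: iterate_in assms)
qed simp

lemma continuous_iterate: "continuous_map (shift_topology \<Lambda>) (shift_topology \<Lambda>) (iterate t)"
proof -
  have "continuous_map X X (k ^^ n)" if "continuous_map X X k" for X :: "(int \<Rightarrow> 'a) topology" and k n
    by (induction n) (simp_all add: id_def continuous_map_compose[OF _ that] del: o_apply)
  with continuous continuous_f_inv show ?thesis by (simp add: iterate_def)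
qed

lemma itinerary_iterate: "x \<in> \<Lambda> \<Longrightarrow> itinerary (iterate p x) = translate p (itinerary x)"
  by (simp add: fun_eq_iff itinerary_def translate_def iterate_add add.commute)

lemma itinerary_f: "x \<in> \<Lambda> \<Longrightarrow> itinerary (f x) = shift (itinerary x)"
  using itinerary_iterate[of x 1] iterate_Suc[of x 0] by (simp add: shift_eq_translate)

lemma segment_itinerary: "segment (itinerary x) n = map (\<lambda>t. g ((f ^^ t) x)) [0..<n]"
  by (simp add: segment_def itinerary_def iterate_nat)

lemma itinerary_in:
  assumes "x \<in> \<Lambda>"
  shows "itinerary x \<in> presented_subshift T"
proof (rule subshiftI_ray)
  fix p
  have "iterate p x \<in> \<Lambda>" using iterate_in[OF assms] .
  then obtain i where "ray S 0 i (translate 0 (iterate p x))"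
    using subshift_iff_ray[OF source] by blast
  then have "ray S (0 * q) i (iterate p x)" by simp
  from labelled_path_orbit[OF this] have "ray T 0 i (itinerary (iterate p x))"
    unfolding ray_def[of T] segment_itinerary by blast
  then show "\<exists>l i. ray T l i (translate p (itinerary x))"
    using itinerary_iterate[OF assms] by metis
qed

lemma segment_eq_iff: "segment x n = segment y n \<longleftrightarrow> (\<forall>t<n. x (int t) = y (int t))"
  by (auto simp: segment_def)

text \<open>Knowing the words at all times, each use of \<open>recover\<close> turns m known symbols
  at time t+1 into at least m+1 at time t. This gives the nonnegative halves at all times; the
  negative half at time t is then gained from earlier times.\<close>

lemma itinerary_inj:
  assumes x: "x \<in> \<Lambda>" and y: "y \<in> \<Lambda>" and eq: "itinerary x = itinerary y"
  shows "x = y"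
proof -
  have label: "g (iterate t x) = g (iterate t y)" for t
    using eq by (simp add: itinerary_def fun_eq_iff)
  have step: "iterate (t + 1) x = f (iterate t x)" "iterate (t + 1) y = f (iterate t y)" for t
    using iterate_Suc x y by auto
  have "segment (iterate t x) m = segment (iterate t y) m" for t m
  proof (induction m arbitrary: t)
    case (Suc m)
    have "segment (iterate t x) (m + e) = segment (iterate t y) (m + e)"
      by (rule recover) (use Suc[of "t + 1"] in \<open>simp_all add: iterate_in x y label step\<close>)
    then show ?case using expanding by (simp add: segment_eq_iff)
  qed simp
  then have "iterate t x (int n) = iterate t y (int n)" for t n
    by (meson lessI segment_eq_iff)
  then have agree: "agree_from 0 (iterate t x) (iterate t y)" for t
    unfolding agree_from_def by (metis nonneg_int_cases)
  \<comment> \<open>Every application of \<open>f\<close> brings e further symbols to the right of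
    position 0, so s steps from time t-s extend the agreement at time t to -s*e.\<close>
  have agree_s: "agree_from (- int (s * e)) (iterate t x) (iterate t y)" for s t
  proof (induction s arbitrary: t)
    case 0
    then show ?case using agree by simp
  next
    case (Suc s)
    have *: "- int (Suc s * e) = - int (s * e) - int e" by simp
    show ?case
      unfolding * using map_agree[OF Suc[of "t - 1"]] step[of "t - 1"] by simp
  qed
  show ?thesis
  proof
    fix i
    have "nat \<bar>i\<bar> * 1 \<le> nat \<bar>i\<bar> * e" using expanding by (intro mult_left_mono) auto
    then have "- int (nat \<bar>i\<bar> * e) \<le> i" by linarith
    then show "x i = y i"
      using agree_s[of "nat \<bar>i\<bar>" 0] by (simp add: agree_from_def)
  qed
qed

text \<open>A window of y of length 2n+1 labels a path, hence the initial words of a ray, which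
  extends to a point; n iterations centre the window.\<close>

lemma itinerary_approx:
  assumes y: "y \<in> presented_subshift T"
  shows "\<exists>x\<in>\<Lambda>. \<forall>t. \<bar>t\<bar> \<le> int n \<longrightarrow> itinerary x t = y t"
proof -
  define z where "z = translate (- int n) y"
  obtain i where "ray T 0 i z"
    using y subshift_iff_ray[OF symbolic_matrix_system_induced] unfolding z_def by blast
  then obtain j where path: "labelled_path T 0 i (segment z (2 * n + 1)) j"
    unfolding ray_def by blast
  \<comment> \<open>A ray issuing from the last vertex is all that is needed to start reading the
    path backwards.\<close>
  then have "j < msize S ((0 + length (segment z (2 * n + 1))) * q)"
    using labelled_path_bounds msize_induced by metis
  then obtain r where "ray S ((0 + length (segment z (2 * n + 1))) * q) j r"
    by (rule ray_exists[OF source])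
  from orbit_of_labelled_path[OF path this] obtain x where x: "ray S (0 * q) i x"
      "map (\<lambda>t. g ((f ^^ t) x)) [0..<2 * n + 1] = segment z (2 * n + 1)"
    by auto
  obtain w where w: "w \<in> \<Lambda>" "agree_from 0 w x"
    by (rule ray_extends_to_point[OF source x(1)])
  have "segment (itinerary w) (2 * n + 1) = segment z (2 * n + 1)"
    unfolding segment_itinerary x(2)[symmetric]
    using label_agree[OF funpow_agree[OF w(2)]] by simp
  then have wz: "itinerary w (int t) = z (int t)" if "t < 2 * n + 1" for t
    using that segment_eq_iff by blast
  have "itinerary (iterate (int n) w) t = y t" if "\<bar>t\<bar> \<le> int n" for t
  proof -
    have nat: "int (nat (int n + t)) = int n + t"
      using that by linarith
    have "itinerary (iterate (int n) w) t = itinerary w (int (nat (int n + t)))"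
      unfolding nat by (simp add: itinerary_iterate[OF w(1)] translate_def)
    also have "\<dots> = z (int (nat (int n + t)))"
      using that by (intro wz) linarith
    also have "\<dots> = y t"
      unfolding nat by (simp add: z_def translate_def)
    finally show ?thesis .
  qed
  with iterate_in[OF w(1)] show ?thesis by blast
qed

lemma continuous_itinerary_at:
  "continuous_map (shift_topology \<Lambda>) (discrete_topology UNIV) (\<lambda>x. itinerary x t)"
  using continuous_map_compose[OF continuous_iterate continuous_label]
  by (simp add: itinerary_def o_def)

text \<open>The points realizing y on the window from -n to n form nested nonempty closed sets;
  compactness gives a point realizing all of y.\<close>

lemma itinerary_surj:
  assumes y: "y \<in> presented_subshift T"
  shows "y \<in> itinerary ` \<Lambda>"
proof -
  let ?X = "shift_topology \<Lambda>"
  define C where "C n = (\<Inter>t\<in>{- int n..int n}. {x \<in> topspace ?X. itinerary x t \<in> {y t}})" for n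
  have "(\<Inter>n. C n) \<noteq> {}"
  proof (rule compact_space_imp_nest[OF compact_presented_subshift[OF source]])
    show "closedin ?X (C n)" for n
      unfolding C_def
      by (intro closedin_INT closedin_continuous_map_preimage[OF continuous_itinerary_at]) auto
    show "C n \<noteq> {}" for n
      using itinerary_approx[OF y, of n] by (auto simp: C_def abs_le_iff)
    show "decseq C"
      unfolding decseq_def C_def by fastforce
  qed
  then obtain x where x: "\<And>n. x \<in> C n" by blast
  have "itinerary x = y"
  proof
    fix t
    have "t \<in> {- int (nat \<bar>t\<bar>)..int (nat \<bar>t\<bar>)}" by auto
    then show "itinerary x t = y t" using x[of "nat \<bar>t\<bar>"] unfolding C_def by blast
  qed
  moreover have "x \<in> \<Lambda>" using x[of 0] by (simp add: C_def)
  ultimately show ?thesis by blast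
qed

lemma conjugate_induced:
  "topologically_conjugate (shift_topology \<Lambda>) f (shift_topology (presented_subshift T)) shift"
  unfolding topologically_conjugate_def
proof (intro conjI exI ballI)
  show "continuous_map (shift_topology \<Lambda>) (shift_topology \<Lambda>) f"
    by (rule continuous)
  show "continuous_map (shift_topology (presented_subshift T)) (shift_topology (presented_subshift T)) shift"
    \<comment> \<open>The shift on the induced subshift is itself the map of a letter transfer, now
      over words as symbols.\<close>
    using transfer.continuous[OF transfer_letter[OF symbolic_matrix_system_induced]] .
  show "homeomorphic_map (shift_topology \<Lambda>) (shift_topology (presented_subshift T)) itinerary"
  proof (rule continuous_imp_homeomorphic_map)
    show "continuous_map (shift_topology \<Lambda>) (shift_topology (presented_subshift T)) itinerary"
      by (rule continuous_map_shift_topologyI) (auto simp: continuous_itinerary_at itinerary_in)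
    show "inj_on itinerary (topspace (shift_topology \<Lambda>))"
      by (auto intro: inj_onI itinerary_inj)
    show "itinerary ` topspace (shift_topology \<Lambda>) = topspace (shift_topology (presented_subshift T))"
      using itinerary_in itinerary_surj by auto
  qed (simp_all add: compact_presented_subshift source Hausdorff_shift_topology)
  show "itinerary (f x) = shift (itinerary x)" if "x \<in> topspace (shift_topology \<Lambda>)" for x
    using that by (simp add: itinerary_f)
qed

end

section \<open>The system of a chain\<close>

lemma transfer_chain:
  assumes "psse_chain N E S" and "j \<le> N"
  shows "\<exists>g. transfer (S 0) (S j) j 0 (P_block (S 0) E j) (forward_automorphism E j) g"
  using assms(2)
proof (induction j)
  case 0
  have "P_block (S 0) E 0 = (\<lambda>l. 1\<^sub>m (msize (S 0) l))"
    by (simp add: P_block_def fun_eq_iff)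
  moreover have "symbolic_matrix_system (S 0)"
    using assms(1) by (simp add: psse_chain_def)
  ultimately show ?case using transfer_id by (metis forward_automorphism.simps(1))
next
  case (Suc j)
  then obtain g where g: "transfer (S 0) (S j) j 0 (P_block (S 0) E j) (forward_automorphism E j) g"
    by auto
  interpret one_step "E (Suc j)" "S j" "S (Suc j)"
  proof
    have "Suc j \<in> {1..N}" using Suc.prems by simp
    then have "psse_one_step (E (Suc j)) (S (Suc j - 1)) (S (Suc j))"
      using assms(1) unfolding psse_chain_def by blast
    then show "psse_one_step (E (Suc j)) (S j) (S (Suc j))" by simp
    show "symbolic_matrix_system (S j)" "symbolic_matrix_system (S (Suc j))"
      using assms(1) Suc.prems unfolding psse_chain_def by simp_all
  qed
  have "P_block (S 0) E (Suc j) l = P_block (S 0) E j l * transfer_matrix (l + j)" for l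
  proof -
    have P: "P_block (S 0) E j l \<in> carrier_mat (msize (S 0) l) (msize (S j) (l + j))"
      using transfer.carrier[OF g] .
    \<comment> \<open>After j steps the path has climbed to level l+j, whose index in the next
      equivalence is 2(l+j).\<close>
    have [simp]: "2 * l + 2 * Suc j - 2 = 2 * (l + j)" "2 * l + 2 * Suc j - 1 = Suc (2 * (l + j))" by simp_all
    have "P_block (S 0) E (Suc j) l = P_block (S 0) E j l * wd (matP (E (Suc j)) (2 * (l + j))) *
        zo (matY (E (Suc j)) (Suc (2 * (l + j))))"
      by (simp add: P_block_def mat_prod_def)
    also have "\<dots> = P_block (S 0) E j l * transfer_matrix (l + j)"
      unfolding transfer_matrix_def
      by (rule assoc_mult_mat[OF P]; unfold wd_carrier zo_carrier; rule P_even_carrier Y_odd_carrier)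
    finally show ?thesis .
  qed
  then have "P_block (S 0) E (Suc j) = (\<lambda>l. P_block (S 0) E j l * transfer_matrix (l + j))" ..
  with transfer_compose[OF g transfer_step] show ?case by (auto simp: o_def)
qed

lemma transfer_power:
  assumes T: "transfer M M N 0 B f g"
  shows "\<exists>g. transfer M M (k * N) 0 (\<lambda>l. mat_prod (msize M l) (map (\<lambda>t. B (l + t * N)) [0..<k])) (f ^^ k) g"
proof (induction k)
  case 0
  show ?case using transfer_id[OF transfer.source[OF T]] by (auto simp: id_def)
next
  case (Suc k)
  then obtain g' where "transfer M M (k * N) 0
      (\<lambda>l. mat_prod (msize M l) (map (\<lambda>t. B (l + t * N)) [0..<k])) (f ^^ k) g'" by blast
  from transfer_compose[OF this T] show ?case by (auto simp: add.commute o_def)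
qed

text \<open>The induction starts at n = 1, since the \<open>P\<close> factors alone may fail to
  reach some vertex from level 0; one letter factor behind them repairs this.\<close>

lemma transfer_letters:
  assumes T: "transfer M M r 0 B f g" and n: "n \<ge> 1"
  shows "\<exists>g. self_transfer M (r + n) n
    (\<lambda>l. foldl (*) (B l) (map (\<lambda>s. wd (sym_mat M s)) [l + r..<l + r + n])) ((shift ^^ n) \<circ> f) g"
  using n
proof (induction n rule: dec_induct)
  case base
  interpret transfer M M r 0 B f g by fact
  interpret C: transfer M M "r + 1" "0 + 1" "\<lambda>l. B l * wd (sym_mat M (l + r))" "shift \<circ> f" "\<lambda>x. g x @ [f x 0]"
    by (rule transfer_compose[OF T transfer_letter[OF source]])
  have "\<exists>i<msize M l. \<exists>w. w \<in># (B l * wd (sym_mat M (l + r))) $$ (i, j)" if j: "j < msize M (l + (r + 1))" for l j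
  proof -
    have c: "wd (sym_mat M (l + r)) \<in> carrier_mat (msize M (l + r)) (msize M (l + (r + 1)))"
      using sym_carrier[OF source, of "l + r"] by simp
    \<comment> \<open>Column j is reached one level up by an edge of \<open>B\<close>; a letter edge
      into its source is put in front, and the exchange turns the pair into an edge of
      \<open>B\<close> from level l followed by a letter.\<close>
    obtain v w where v: "v < msize M (Suc l)" "w \<in># B (Suc l) $$ (v, j)"
      using column[of j l] j by auto
    obtain h a where h: "h < msize M l" "a \<in># sym_mat M l $$ (h, v)"
      using receives[OF source v(1)] by blast
    obtain v' w' a' where "v' < msize M (l + r)" "w' \<in># B l $$ (h, v')" "a' \<in># sym_mat M (l + r) $$ (v', j)"
      using exchange[OF h(1) v(1) _ h(2) v(2)] j by auto
    then have "w' @ [a'] \<in># (B l * wd (sym_mat M (l + r))) $$ (h, j)"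
      using mem_mult_mat[OF carrier c h(1) j] mem_wd[OF sym_carrier[OF source, of "l + r"], of v' j "[a']"] j by auto
    with h show ?thesis by blast
  qed
  then have "self_transfer M (r + 1) (0 + 1) (\<lambda>l. B l * wd (sym_mat M (l + r))) (shift \<circ> f) (\<lambda>x. g x @ [f x 0])"
    by unfold_locales auto
  then show ?case by (auto simp: o_def)
next
  case (step n)
  then obtain g' where "self_transfer M (r + n) n
    (\<lambda>l. foldl (*) (B l) (map (\<lambda>s. wd (sym_mat M s)) [l + r..<l + r + n])) ((shift ^^ n) \<circ> f) g'" by blast
  then interpret self_transfer M "r + n" n
    "\<lambda>l. foldl (*) (B l) (map (\<lambda>s. wd (sym_mat M s)) [l + r..<l + r + n])" "(shift ^^ n) \<circ> f" g' .
  let ?F = "\<lambda>l. foldl (*) (B l) (map (\<lambda>s. wd (sym_mat M s)) [l + r..<l + r + n])"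
  have F: "(\<lambda>l. foldl (*) (B l) (map (\<lambda>s. wd (sym_mat M s)) [l + r..<l + r + Suc n])) =
      (\<lambda>l. ?F l * wd (sym_mat M (l + (r + n))))"
    by (simp add: fun_eq_iff add.assoc)
  have f: "(shift ^^ Suc n) \<circ> f = shift \<circ> ((shift ^^ n) \<circ> f)"
    by (simp add: o_assoc)
  interpret C: transfer M M "(r + n) + 1" "n + 1" "\<lambda>l. ?F l * wd (sym_mat M (l + (r + n)))"
    "shift \<circ> ((shift ^^ n) \<circ> f)" "\<lambda>x. g' x @ [((shift ^^ n) \<circ> f) x 0]"
    by (rule transfer_compose[OF transfer_axioms transfer_letter[OF source]])
  have "\<exists>i<msize M l. \<exists>w. w \<in># (?F l * wd (sym_mat M (l + (r + n)))) $$ (i, j)"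
    if j: "j < msize M (l + (r + n + 1))" for l j
  proof -
    have j': "j < msize M (Suc (l + (r + n)))" using j by simp
    have c: "wd (sym_mat M (l + (r + n))) \<in> carrier_mat (msize M (l + (r + n))) (msize M (l + (r + n + 1)))"
      using sym_carrier[OF source, of "l + (r + n)"] by simp
    obtain v a where v: "v < msize M (l + (r + n))" "a \<in># sym_mat M (l + (r + n)) $$ (v, j)"
      using receives[OF source j'] by blast
    obtain i w where i: "i < msize M l" "w \<in># ?F l $$ (i, v)"
      using receiving[OF v(1)] by blast
    have "w @ [a] \<in># (?F l * wd (sym_mat M (l + (r + n)))) $$ (i, j)"
      using mem_mult_mat[OF carrier c i(1) j] mem_wd[OF sym_carrier[OF source] v(1) j', of "[a]"] v i by blast
    with i show ?thesis by blast
  qed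
  then have "self_transfer M (r + n + 1) (n + 1) (\<lambda>l. ?F l * wd (sym_mat M (l + (r + n))))
      (shift \<circ> ((shift ^^ n) \<circ> f)) (\<lambda>x. g' x @ [((shift ^^ n) \<circ> f) x 0])"
    by unfold_locales auto
  then show ?case unfolding F f by (auto simp: o_def)
qed

lemma step_map_shift: "step_map E (shift x) = shift (step_map E x)"
  by (simp add: fun_eq_iff step_map_eq shift_def)

lemma forward_automorphism_shift: "forward_automorphism E j (shift x) = shift (forward_automorphism E j x)"
  by (induction j) (simp_all add: step_map_shift)

theorem theorem7p8:
  fixes S :: "nat \<Rightarrow> 'a matrix_system"
    and E :: "nat \<Rightarrow> 'a psse_data"
    and M :: "'a matrix_system"
    and \<phi> :: "(int \<Rightarrow> 'a) \<Rightarrow> int \<Rightarrow> 'a"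
    and N k n :: nat
  assumes "symbolic_matrix_system M"
    and "N \<ge> 1"
    and "psse_chain N E S"
    and "S 0 = M" and "S N = M"
    and "\<phi> = forward_automorphism E N"
    and "n \<ge> 1"
  shows "symbolic_matrix_system (PM_system M E N k n) \<and>
    topologically_conjugate
      (shift_topology (presented_subshift M)) ((\<phi> ^^ k) \<circ> (shift ^^ n))
      (shift_topology (presented_subshift (PM_system M E N k n))) shift"
proof -
  obtain g where "transfer M M N 0 (P_block M E N) \<phi> g"
    using transfer_chain[OF assms(3), of N] assms(4-6) by auto
  then obtain g' where g': "transfer M M (k * N) 0
      (\<lambda>l. mat_prod (msize M l) (map (\<lambda>t. P_block M E N (l + t * N)) [0..<k])) (\<phi> ^^ k) g'"
    using transfer_power by blast
  let ?F = "\<lambda>l. foldl (*) (mat_prod (msize M l) (map (\<lambda>t. P_block M E N (l + t * N)) [0..<k]))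
      (map (\<lambda>s. wd (sym_mat M s)) [l + k * N..<l + k * N + n])"
  obtain g'' where "self_transfer M (k * N + n) n ?F ((shift ^^ n) \<circ> (\<phi> ^^ k)) g''"
    using transfer_letters[OF g' assms(7)] by blast
  then interpret self_transfer M "k * N + n" n ?F "(shift ^^ n) \<circ> (\<phi> ^^ k)" g'' .
  \<comment> \<open>Folding over the appended list amounts to folding the letters onto the product
    of the \<open>P\<close> blocks, at level l(kN+n).\<close>
  have "PM_mat M E N k n = (\<lambda>l. ?F (l * (k * N + n)))"
    by (simp add: fun_eq_iff PM_mat_def Let_def mat_prod_def ac_simps)
  then have T: "T = PM_system M E N k n"
    by (simp add: induced_system_def PM_system_def)
  \<comment> \<open>The transfers produced the composition in the other order, with the shifts
    applied last.\<close>
  have "(\<phi> ^^ k) (shift x) = shift ((\<phi> ^^ k) x)" for x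
    by (induction k) (simp_all add: assms(6) forward_automorphism_shift)
  then have "(\<phi> ^^ k) ((shift ^^ m) x) = (shift ^^ m) ((\<phi> ^^ k) x)" for m x
    by (induction m) simp_all
  then have "(\<phi> ^^ k) \<circ> (shift ^^ n) = (shift ^^ n) \<circ> (\<phi> ^^ k)"
    by (simp add: fun_eq_iff)
  with symbolic_matrix_system_induced conjugate_induced show ?thesis
    unfolding T by simp
qed

end
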